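(* Let $B$ be a commutative $k$-algebra and let $I\subset B$ be an ideal with $I^2=0$. Let $(E,\eta)$ be an object of the dg-category $MC(\mathcal P\otimes_k B)$ and let $(F,\zeta_I)$ be an object of the dg-category $MC(\mathcal P\otimes_k B/I)$. Put $\eta_I:=\eta\otimes_B B/I$, the image of $\eta$ in $\mathcal P^1(E,E)\otimes_k B/I$. Let $$\alpha_I\in \mathcal P^0(F,E)\otimes_k B/I,\qquad a_I\in\mathcal P^0(E,F)\otimes_k B/I$$ be morphisms of MC-objects $\alpha_I:(F,\zeta_I)\to(E,\eta_I)$ and $a_I:(E,\eta_I)\to(F,\zeta_I)$ (that is, closed of degree $0$: $d_{\zeta_I,\eta_I}(\alpha_I)=0$ and $d_{\eta_I,\zeta_I}(a_I)=0$) whose classes are inverse to each other in $H^0(MC(\mathcal P\otimes_k B/I))$. Then there exist $\zeta\in\mathcal P^1(F,F)\otimes_k B$ lifting $\zeta_I$ and $\alpha\in\mathcal P^0(F,E)\otimes_k B$ lifting $\alpha_I$ (i.e. reducing modulo $I$ to $\zeta_I$ and $\alpha_I$ respectively) such that $$d(\zeta)+\zeta^2=0\qquad\text{and}\qquad d_{\zeta,\eta}(\alpha)=0 .$$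
   Context: Standing assumptions: $k$ is an algebraically closed field of characteristic $0$ and $\mathcal P$ is a fixed $k$-linear dg-category such that (1) the set of objects $Ob(\mathcal P)$ is finite; (2) for all objects $E,F$ and all $i\in\mathbb Z$, $\mathcal P^i(E,F)$ is a finite-dimensional $k$-vector space; (3) there is $n>0$ such that $\mathcal P^i(E,F)=0$ for all $E,F$ and all $i<-n$. Conventions for a dg-category: the complexes $(\mathcal P^{\cdot}(E,F),d)$ are cohomological ($d$ has degree $+1$), composition is bilinear and associative, $1\in\mathcal P^0(E,E)$ with $d(1)=0$, and $d(\beta\alpha)=d(\beta)\alpha+(-1)^{|\beta|}\beta\, d(\alpha)$. For a commutative $k$-algebra $R$, $\mathcal P\otimes_k R$ is the $R$-linear dg-category with the same objects as $\mathcal P$ and $(\mathcal P\otimes_k R)(E,F):=\mathcal P(E,F)\otimes_k R$. For a dg-category $\mathcal Q$, a Maurer-Cartan element for an object $E$ is $\eta\in\mathcal Q^1(E,E)$ with $d(\eta)+\eta\cdot\eta=0$. The dg-category $MC(\mathcal Q)$ has as objects the pairs $(E,\eta)$ with $E\in Ob(\mathcal Q)$ and $\eta$ a Maurer-Cartan element for $E$; its morphism complex from $(E,\eta)$ to $(F,\zeta)$ is $(\mathcal Q^{\cdot}(E,F),d_{\eta,\zeta})$, where for $a\in\mathcal Q^i(E,F)$ $$d_{\eta,\zeta}(a):=d(a)+\zeta a-(-1)^i a\eta ,$$ with the same composition and identities as $\mathcal Q$. The operator $d_{\eta,\zeta}$ is defined by the same formula for arbitrary degree-one elements $\eta\in\mathcal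 Q^1(E,E)$, $\zeta\in\mathcal Q^1(F,F)$. $H^0$ of a dg-category denotes the category with the same objects and with morphisms the $H^0$ of the morphism complexes. *)

theory Defs
  imports "HOL-Algebra.Algebra"
begin

section \<open>Fields and vector spaces\<close>

definition char_zero :: "('k, 'x) ring_scheme \<Rightarrow> bool"
  where "char_zero K \<longleftrightarrow> (\<forall>n::nat. n > 0 \<longrightarrow> [n] \<cdot>\<^bsub>K\<^esub> \<one>\<^bsub>K\<^esub> \<noteq> \<zero>\<^bsub>K\<^esub>)"

definition finite_dim :: "('k, 'x) ring_scheme \<Rightarrow> ('k, 'm, 'y) module_scheme \<Rightarrow> bool"
  where "finite_dim K V \<longleftrightarrow> (\<exists>A. finite A \<and> A \<subseteq> carrier V \<and>
    (\<forall>v\<in>carrier V. \<exists>c\<in>A \<rightarrow> carrier K. v = (\<Oplus>\<^bsub>V\<^esub>a\<in>A. c a \<odot>\<^bsub>V\<^esub> a)))"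

text \<open>The quotient ring \<open>B Quot I\<close>, made into a \<open>k\<close>-algebra.\<close>

definition quot_algebra :: "('k, 'b) module \<Rightarrow> 'b set \<Rightarrow> ('k, 'b set) module"
  where "quot_algebra B I =
    ring.extend (B Quot I)
      (module.fields (\<lambda>c \<xi>. \<Union>x\<in>\<xi>. I +>\<^bsub>B\<^esub> (c \<odot>\<^bsub>B\<^esub> x)))"


section \<open>Dg-categories\<close>

text \<open>
  \<open>Hom Q E F i\<close> is the degree \<open>i\<close> part of the morphism complex from \<open>E\<close> to \<open>F\<close>; only the
  additive group and the scalar multiplication of this record are relevant, its ring
  multiplication and unit are not used.
  \<open>Comp Q E F G j i \<beta> \<alpha>\<close> is the composite \<open>\<beta>\<alpha>\<close> of \<open>\<alpha>\<close>, of degree \<open>i\<close> from \<open>E\<close> to \<open>F\<close>, and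
  \<open>\<beta>\<close>, of degree \<open>j\<close> from \<open>F\<close> to \<open>G\<close>.
\<close>

record ('o, 'r, 'm) dgcat =
  Ob :: "'o set"
  Hom :: "'o \<Rightarrow> 'o \<Rightarrow> int \<Rightarrow> ('r, 'm) module"
  Diff :: "'o \<Rightarrow> 'o \<Rightarrow> int \<Rightarrow> 'm \<Rightarrow> 'm"
  Comp :: "'o \<Rightarrow> 'o \<Rightarrow> 'o \<Rightarrow> int \<Rightarrow> int \<Rightarrow> 'm \<Rightarrow> 'm \<Rightarrow> 'm"
  Ident :: "'o \<Rightarrow> 'm"

text \<open>The element \<open>(-1)\<^sup>i x\<close> of \<open>M\<close>.\<close>

definition signed :: "('m, 'x) ring_scheme \<Rightarrow> int \<Rightarrow> 'm \<Rightarrow> 'm"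
  where "signed M i x = (if even i then x else \<ominus>\<^bsub>M\<^esub> x)"

locale dg_category = cring R for R :: "('r, 'x) ring_scheme" (structure) +
  fixes Q :: "('o, 'r, 'm) dgcat" (structure)
  assumes Hom_module:
      "\<lbrakk> E \<in> Ob Q; F \<in> Ob Q \<rbrakk> \<Longrightarrow> module R (Hom Q E F i)"
    and Diff_closed:
      "\<lbrakk> E \<in> Ob Q; F \<in> Ob Q; a \<in> carrier (Hom Q E F i) \<rbrakk> \<Longrightarrow>
        Diff Q E F i a \<in> carrier (Hom Q E F (i + 1))"
    and Diff_add:
      "\<lbrakk> E \<in> Ob Q; F \<in> Ob Q; a \<in> carrier (Hom Q E F i); b \<in> carrier (Hom Q E F i) \<rbrakk> \<Longrightarrow>
        Diff Q E F i (a \<oplus>\<^bsub>Hom Q E F i\<^esub> b) =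
          Diff Q E F i a \<oplus>\<^bsub>Hom Q E F (i + 1)\<^esub> Diff Q E F i b"
    and Diff_smult:
      "\<lbrakk> E \<in> Ob Q; F \<in> Ob Q; r \<in> carrier R; a \<in> carrier (Hom Q E F i) \<rbrakk> \<Longrightarrow>
        Diff Q E F i (r \<odot>\<^bsub>Hom Q E F i\<^esub> a) = r \<odot>\<^bsub>Hom Q E F (i + 1)\<^esub> Diff Q E F i a"
    and Diff_Diff:
      "\<lbrakk> E \<in> Ob Q; F \<in> Ob Q; a \<in> carrier (Hom Q E F i) \<rbrakk> \<Longrightarrow>
        Diff Q E F (i + 1) (Diff Q E F i a) = \<zero>\<^bsub>Hom Q E F (i + 2)\<^esub>"
    and Comp_closed:
      "\<lbrakk> E \<in> Ob Q; F \<in> Ob Q; G \<in> Ob Q; b \<in> carrier (Hom Q F G j); a \<in> carrier (Hom Q E F i) \<rbrakk> \<Longrightarrow>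
        Comp Q E F G j i b a \<in> carrier (Hom Q E G (j + i))"
    and Comp_add_left:
      "\<lbrakk> E \<in> Ob Q; F \<in> Ob Q; G \<in> Ob Q; b \<in> carrier (Hom Q F G j); b' \<in> carrier (Hom Q F G j);
         a \<in> carrier (Hom Q E F i) \<rbrakk> \<Longrightarrow>
        Comp Q E F G j i (b \<oplus>\<^bsub>Hom Q F G j\<^esub> b') a =
          Comp Q E F G j i b a \<oplus>\<^bsub>Hom Q E G (j + i)\<^esub> Comp Q E F G j i b' a"
    and Comp_add_right:
      "\<lbrakk> E \<in> Ob Q; F \<in> Ob Q; G \<in> Ob Q; b \<in> carrier (Hom Q F G j);
         a \<in> carrier (Hom Q E F i); a' \<in> carrier (Hom Q E F i) \<rbrakk> \<Longrightarrow>
        Comp Q E F G j i b (a \<oplus>\<^bsub>Hom Q E F i\<^esub> a') =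
          Comp Q E F G j i b a \<oplus>\<^bsub>Hom Q E G (j + i)\<^esub> Comp Q E F G j i b a'"
    and Comp_smult_left:
      "\<lbrakk> E \<in> Ob Q; F \<in> Ob Q; G \<in> Ob Q; r \<in> carrier R;
         b \<in> carrier (Hom Q F G j); a \<in> carrier (Hom Q E F i) \<rbrakk> \<Longrightarrow>
        Comp Q E F G j i (r \<odot>\<^bsub>Hom Q F G j\<^esub> b) a =
          r \<odot>\<^bsub>Hom Q E G (j + i)\<^esub> Comp Q E F G j i b a"
    and Comp_smult_right:
      "\<lbrakk> E \<in> Ob Q; F \<in> Ob Q; G \<in> Ob Q; r \<in> carrier R;
         b \<in> carrier (Hom Q F G j); a \<in> carrier (Hom Q E F i) \<rbrakk> \<Longrightarrow>
        Comp Q E F G j i b (r \<odot>\<^bsub>Hom Q E F i\<^esub> a) =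
          r \<odot>\<^bsub>Hom Q E G (j + i)\<^esub> Comp Q E F G j i b a"
    and Comp_assoc:
      "\<lbrakk> E \<in> Ob Q; F \<in> Ob Q; G \<in> Ob Q; H \<in> Ob Q; c \<in> carrier (Hom Q G H l);
         b \<in> carrier (Hom Q F G j); a \<in> carrier (Hom Q E F i) \<rbrakk> \<Longrightarrow>
        Comp Q E F H (l + j) i (Comp Q F G H l j c b) a =
          Comp Q E G H l (j + i) c (Comp Q E F G j i b a)"
    and Ident_closed:
      "E \<in> Ob Q \<Longrightarrow> Ident Q E \<in> carrier (Hom Q E E 0)"
    and Comp_Ident_left:
      "\<lbrakk> E \<in> Ob Q; F \<in> Ob Q; a \<in> carrier (Hom Q E F i) \<rbrakk> \<Longrightarrow>
        Comp Q E F F 0 i (Ident Q F) a = a"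
    and Comp_Ident_right:
      "\<lbrakk> E \<in> Ob Q; F \<in> Ob Q; a \<in> carrier (Hom Q E F i) \<rbrakk> \<Longrightarrow>
        Comp Q E E F i 0 a (Ident Q E) = a"
    and Diff_Ident:
      "E \<in> Ob Q \<Longrightarrow> Diff Q E E 0 (Ident Q E) = \<zero>\<^bsub>Hom Q E E 1\<^esub>"
    and Diff_Comp:
      "\<lbrakk> E \<in> Ob Q; F \<in> Ob Q; G \<in> Ob Q; b \<in> carrier (Hom Q F G j); a \<in> carrier (Hom Q E F i) \<rbrakk> \<Longrightarrow>
        Diff Q E G (j + i) (Comp Q E F G j i b a) =
          Comp Q E F G (j + 1) i (Diff Q F G j b) a
            \<oplus>\<^bsub>Hom Q E G (j + i + 1)\<^esub>
          signed (Hom Q E G (j + i + 1)) j (Comp Q E F G j (i + 1) b (Diff Q E F i a))"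


section \<open>Extension of scalars\<close>

text \<open>
  For a module \<open>V\<close> over \<open>K\<close> and a commutative \<open>K\<close>-algebra \<open>R\<close>, the tensor product of \<open>V\<close> and \<open>R\<close>
  over \<open>K\<close> is the free abelian group on the pairs \<open>(v, r)\<close> modulo the usual relations. Its
  elements are cosets; all operations on it are given by their values on generators, extended
  additively and applied to all representatives of a coset.
\<close>

abbreviation tensor_free ::
    "('k, 'm) module \<Rightarrow> ('k, 'b) module \<Rightarrow> ('m \<times> 'b \<Rightarrow>\<^sub>0 int) monoid"
  where "tensor_free V R \<equiv> free_Abelian_group (carrier V \<times> carrier R)"

definition tensor_relations ::
    "('k, 'x) ring_scheme \<Rightarrow> ('k, 'm) module \<Rightarrow> ('k, 'b) module \<Rightarrow> ('m \<times> 'b \<Rightarrow>\<^sub>0 int) set"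
  where "tensor_relations K V R = generate (tensor_free V R)
    ({frag_of (v \<oplus>\<^bsub>V\<^esub> w, r) - frag_of (v, r) - frag_of (w, r) | v w r.
        v \<in> carrier V \<and> w \<in> carrier V \<and> r \<in> carrier R} \<union>
     {frag_of (v, r \<oplus>\<^bsub>R\<^esub> s) - frag_of (v, r) - frag_of (v, s) | v r s.
        v \<in> carrier V \<and> r \<in> carrier R \<and> s \<in> carrier R} \<union>
     {frag_of (c \<odot>\<^bsub>V\<^esub> v, r) - frag_of (v, c \<odot>\<^bsub>R\<^esub> r) | c v r.
        c \<in> carrier K \<and> v \<in> carrier V \<and> r \<in> carrier R})"

definition tensor_class ::
    "('k, 'x) ring_scheme \<Rightarrow> ('k, 'm) module \<Rightarrow> ('k, 'b) module \<Rightarrow>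
     ('m \<times> 'b \<Rightarrow>\<^sub>0 int) \<Rightarrow> ('m \<times> 'b \<Rightarrow>\<^sub>0 int) set"
  where "tensor_class K V R x = tensor_relations K V R #>\<^bsub>tensor_free V R\<^esub> x"

definition base_change ::
    "('k, 'x) ring_scheme \<Rightarrow> ('k, 'm) module \<Rightarrow> ('k, 'b) module \<Rightarrow>
     ('b, ('m \<times> 'b \<Rightarrow>\<^sub>0 int) set) module"
  where "base_change K V R =
    (let T = tensor_free V R Mod tensor_relations K V R in
     \<lparr> carrier = carrier T, monoid.mult = undefined, one = undefined,
       ring.zero = one T, ring.add = monoid.mult T,
       smult = (\<lambda>r \<xi>. \<Union>x\<in>\<xi>. tensor_class K V R
         (frag_extend (\<lambda>(v, s). frag_of (v, r \<otimes>\<^bsub>R\<^esub> s)) x)) \<rparr>)"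

definition dg_base_change ::
    "('k, 'x) ring_scheme \<Rightarrow> ('o, 'k, 'm) dgcat \<Rightarrow> ('k, 'b) module \<Rightarrow>
     ('o, 'b, ('m \<times> 'b \<Rightarrow>\<^sub>0 int) set) dgcat"
  where "dg_base_change K P R =
    \<lparr> Ob = Ob P,
      Hom = (\<lambda>E F i. base_change K (Hom P E F i) R),
      Diff = (\<lambda>E F i \<xi>. \<Union>x\<in>\<xi>. tensor_class K (Hom P E F (i + 1)) R
        (frag_extend (\<lambda>(a, r). frag_of (Diff P E F i a, r)) x)),
      Comp = (\<lambda>E F G j i \<upsilon> \<xi>. \<Union>y\<in>\<upsilon>. \<Union>x\<in>\<xi>. tensor_class K (Hom P E G (j + i)) R
        (frag_extend (\<lambda>(b, s).
           frag_extend (\<lambda>(a, r). frag_of (Comp P E F G j i b a, s \<otimes>\<^bsub>R\<^esub> r)) x) y)),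
      Ident = (\<lambda>E. tensor_class K (Hom P E E 0) R (frag_of (Ident P E, \<one>\<^bsub>R\<^esub>))) \<rparr>"

text \<open>The map on tensor products with \<open>V\<close> induced by the projection from \<open>B\<close> to \<open>B Quot I\<close>.\<close>

definition reduction ::
    "('k, 'x) ring_scheme \<Rightarrow> ('k, 'm) module \<Rightarrow> ('k, 'b) module \<Rightarrow> 'b set \<Rightarrow>
     ('m \<times> 'b \<Rightarrow>\<^sub>0 int) set \<Rightarrow> ('m \<times> 'b set \<Rightarrow>\<^sub>0 int) set"
  where "reduction K V B I \<xi> = (\<Union>x\<in>\<xi>. tensor_class K V (quot_algebra B I)
    (frag_extend (\<lambda>(v, b). frag_of (v, I +>\<^bsub>B\<^esub> b)) x))"


section \<open>Maurer-Cartan elements\<close>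

definition MC_elements :: "('o, 'r, 'm) dgcat \<Rightarrow> 'o \<Rightarrow> 'm set"
  where "MC_elements Q E = {\<eta> \<in> carrier (Hom Q E E 1).
    Diff Q E E 1 \<eta> \<oplus>\<^bsub>Hom Q E E 2\<^esub> Comp Q E E E 1 1 \<eta> \<eta> = \<zero>\<^bsub>Hom Q E E 2\<^esub>}"

definition twisted_Diff ::
    "('o, 'r, 'm) dgcat \<Rightarrow> 'o \<Rightarrow> 'o \<Rightarrow> 'm \<Rightarrow> 'm \<Rightarrow> int \<Rightarrow> 'm \<Rightarrow> 'm"
  where "twisted_Diff Q E F \<eta> \<zeta> i a =
    Diff Q E F i a \<oplus>\<^bsub>Hom Q E F (i + 1)\<^esub> Comp Q E F F 1 i \<zeta> a
      \<ominus>\<^bsub>Hom Q E F (i + 1)\<^esub> signed (Hom Q E F (i + 1)) i (Comp Q E E F i 1 a \<eta>)"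

definition MC :: "('o, 'r, 'm) dgcat \<Rightarrow> ('o \<times> 'm, 'r, 'm) dgcat"
  where "MC Q =
    \<lparr> Ob = {(E, \<eta>). E \<in> Ob Q \<and> \<eta> \<in> MC_elements Q E},
      Hom = (\<lambda>(E, \<eta>) (F, \<zeta>). Hom Q E F),
      Diff = (\<lambda>(E, \<eta>) (F, \<zeta>). twisted_Diff Q E F \<eta> \<zeta>),
      Comp = (\<lambda>(E, \<eta>) (F, \<zeta>) (G, \<theta>). Comp Q E F G),
      Ident = (\<lambda>(E, \<eta>). Ident Q E) \<rparr>"


section \<open>The zeroth cohomology category\<close>

record ('o, 'a) cat =
  cat_Ob :: "'o set"
  cat_Hom :: "'o \<Rightarrow> 'o \<Rightarrow> 'a set"
  cat_Comp :: "'o \<Rightarrow> 'o \<Rightarrow> 'o \<Rightarrow> 'a \<Rightarrow> 'a \<Rightarrow> 'a"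
  cat_Ident :: "'o \<Rightarrow> 'a"

definition mutually_inverse :: "('o, 'a) cat \<Rightarrow> 'o \<Rightarrow> 'o \<Rightarrow> 'a \<Rightarrow> 'a \<Rightarrow> bool"
  where "mutually_inverse C U V f g \<longleftrightarrow>
    f \<in> cat_Hom C U V \<and> g \<in> cat_Hom C V U \<and>
    cat_Comp C U V U g f = cat_Ident C U \<and> cat_Comp C V U V f g = cat_Ident C V"

definition closed0 :: "('o, 'r, 'm) dgcat \<Rightarrow> 'o \<Rightarrow> 'o \<Rightarrow> 'm set"
  where "closed0 Q U V = {f \<in> carrier (Hom Q U V 0). Diff Q U V 0 f = \<zero>\<^bsub>Hom Q U V 1\<^esub>}"

definition exact0 :: "('o, 'r, 'm) dgcat \<Rightarrow> 'o \<Rightarrow> 'o \<Rightarrow> 'm set"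
  where "exact0 Q U V = Diff Q U V (-1) ` carrier (Hom Q U V (-1))"

definition H0_class :: "('o, 'r, 'm) dgcat \<Rightarrow> 'o \<Rightarrow> 'o \<Rightarrow> 'm \<Rightarrow> 'm set"
  where "H0_class Q U V f = exact0 Q U V +>\<^bsub>Hom Q U V 0\<^esub> f"

definition H0 :: "('o, 'r, 'm) dgcat \<Rightarrow> ('o, 'm set) cat"
  where "H0 Q =
    \<lparr> cat_Ob = Ob Q,
      cat_Hom = (\<lambda>U V. H0_class Q U V ` closed0 Q U V),
      cat_Comp = (\<lambda>U V W g f. \<Union>b\<in>g. \<Union>a\<in>f. H0_class Q U W (Comp Q U V W 0 0 b a)),
      cat_Ident = (\<lambda>U. H0_class Q U U (Ident Q U)) \<rparr>"

end

theory Submission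
  imports Defs
begin

text \<open>
  The theorem is a statement about a square-zero extension of dg-categories. Reduction modulo \<open>I\<close>
  is a surjective dg-functor \<open>p\<close> from \<open>P \<otimes> B\<close> to \<open>P \<otimes> B/I\<close>, and two morphisms in its kernel \<open>J\<close>
  compose to zero because \<open>I\<^sup>2 = 0\<close>. Choose arbitrary lifts \<open>\<zeta>\<close> and \<open>\<alpha>\<close> of \<open>\<zeta>\<^sub>I\<close> and \<open>\<alpha>\<^sub>I\<close>. Their
  failures to solve the equations are the curvature \<open>\<kappa> = d\<zeta> + \<zeta>\<^sup>2\<close> and \<open>\<nu> = D\<alpha>\<close>, where \<open>D\<close> stands
  for all differentials twisted by \<open>\<zeta>\<close> and \<open>\<eta>\<close>; both lie in \<open>J\<close>. Replacing the lifts by \<open>\<zeta> + u\<close>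
  and \<open>\<alpha> + v\<close> with \<open>u\<close>, \<open>v\<close> in \<open>J\<close> changes the failures to \<open>\<kappa> + Du\<close> and \<open>\<nu> + Dv - \<alpha>u\<close>, since the
  quadratic terms vanish. So one has to solve \<open>Du = -\<kappa>\<close> and \<open>\<alpha>u - Dv = \<nu>\<close>.

  On \<open>J\<close> the operator \<open>D\<close> is a differential, and composition with a morphism depends only on the
  reduction of that morphism. The Bianchi identity \<open>D\<kappa> = 0\<close> and the identity \<open>D\<nu> = -\<alpha>\<kappa>\<close>, which is
  the formula for the square of a twisted differential, say that \<open>(\<kappa>, \<nu>)\<close> is a cocycle in the
  cone of the map \<open>\<alpha>\<close> from \<open>J(F, F)\<close> to \<open>J(F, E)\<close>. This map is a homotopy equivalence with
  inverse \<open>a\<close>, hence the cone is acyclic. Explicitly, let \<open>a\<alpha> = 1 + Dg\<close> and \<open>\<alpha>a = 1 + Dh\<close> modulo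
  \<open>J\<close>. Then \<open>u\<^sub>0 = a\<nu> + g\<kappa>\<close> solves the first equation, \<open>y = \<alpha>u\<^sub>0 - \<nu>\<close> is closed, and
  \<open>u = u\<^sub>0 - ay\<close>, \<open>v = -hy\<close> solve both. This is \<open>homotopy_equivalence_lifts\<close>.

  To apply it, tensor products given by generators and relations have to be seen to form
  dg-categories (\<open>dg_category_base_change\<close>), and \<open>J\<close> has to be identified: right exactness of the
  tensor product (\<open>reduction_kernel\<close>) shows that \<open>J\<close> is spanned by the tensors \<open>v \<otimes> i\<close> with
  \<open>i \<in> I\<close>, which makes compositions within \<open>J\<close> vanish.
\<close>

section \<open>Additive maps and signs\<close>

lemma additive_zero_minus:
  assumes "abelian_group M" "abelian_group N"
    and closed: "\<And>x. x \<in> carrier M \<Longrightarrow> f x \<in> carrier N"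
    and add: "\<And>x y. x \<in> carrier M \<Longrightarrow> y \<in> carrier M \<Longrightarrow> f (x \<oplus>\<^bsub>M\<^esub> y) = f x \<oplus>\<^bsub>N\<^esub> f y"
  shows "f \<zero>\<^bsub>M\<^esub> = \<zero>\<^bsub>N\<^esub>" "x \<in> carrier M \<Longrightarrow> f (\<ominus>\<^bsub>M\<^esub> x) = \<ominus>\<^bsub>N\<^esub> f x"
proof -
  interpret abelian_group_hom M N f
    using assms
    by (intro abelian_group_homI group_hom.intro group_hom_axioms.intro)
      (auto simp: hom_def abelian_group.a_group)
  show "f \<zero>\<^bsub>M\<^esub> = \<zero>\<^bsub>N\<^esub>" "x \<in> carrier M \<Longrightarrow> f (\<ominus>\<^bsub>M\<^esub> x) = \<ominus>\<^bsub>N\<^esub> f x"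
    by (simp_all add: hom_zero)
qed

lemma signed_closed [simp]:
  "abelian_group M \<Longrightarrow> x \<in> carrier M \<Longrightarrow> signed M i x \<in> carrier M"
  by (simp add: signed_def abelian_group.a_inv_closed)

lemma signed_add:
  "abelian_group M \<Longrightarrow> x \<in> carrier M \<Longrightarrow> y \<in> carrier M \<Longrightarrow>
    signed M i (x \<oplus>\<^bsub>M\<^esub> y) = signed M i x \<oplus>\<^bsub>M\<^esub> signed M i y"
  by (simp add: signed_def abelian_group.minus_add)

section \<open>Normalisation in abelian groups\<close>

text \<open>
  In a sum sorted by an ordering that places all negated summands last, \<open>x\<close> and \<open>\<ominus> x\<close> need not be
  adjacent. These rules cancel them across one or two summands in between.
\<close>

lemma (in abelian_group)
  assumes "x \<in> carrier G" "y \<in> carrier G"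
  shows cancel_across1: "x \<oplus> (y \<oplus> \<ominus> x) = y"
    and cancel_across2: "z \<in> carrier G \<Longrightarrow> x \<oplus> (y \<oplus> (\<ominus> x \<oplus> z)) = y \<oplus> z"
    and cancel_across3: "z \<in> carrier G \<Longrightarrow> x \<oplus> (y \<oplus> (z \<oplus> \<ominus> x)) = y \<oplus> z"
  using assms by (simp_all add: a_lcomm[of x] r_neg r_neg2)

text \<open>
  The sign computations below are identities between sums of composites, all in one group of
  morphisms. Such a group carries no multiplication, so normalisation in rings does not apply to it.
\<close>

lemmas (in abelian_group) abelian_group_simprules
  [algebra abelian_group "ring.zero G" "ring.add G" "a_inv G" "a_minus G"] =
  a_closed zero_closed a_inv_closed minus_closed a_assoc l_zero l_neg a_comm minus_eq
  r_zero r_neg r_neg2 r_neg1 minus_add minus_minus minus_zero a_lcomm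
  cancel_across1 cancel_across2 cancel_across3

section \<open>Twisted differentials and curvature\<close>

context dg_category
begin

lemma Hom_abelian_group: "E \<in> Ob Q \<Longrightarrow> F \<in> Ob Q \<Longrightarrow> abelian_group (Hom Q E F i)"
  using Hom_module by (simp add: module_def)

lemma Diff_minus:
  assumes "E \<in> Ob Q" "F \<in> Ob Q" "a \<in> carrier (Hom Q E F i)"
  shows "Diff Q E F i (\<ominus>\<^bsub>Hom Q E F i\<^esub> a) = \<ominus>\<^bsub>Hom Q E F (i + 1)\<^esub> Diff Q E F i a"
  using additive_zero_minus[of "Hom Q E F i" "Hom Q E F (i + 1)" "Diff Q E F i"] assms
  by (simp add: Hom_abelian_group Diff_closed Diff_add)

lemma
  assumes "E \<in> Ob Q" "F \<in> Ob Q" "G \<in> Ob Q" "b \<in> carrier (Hom Q F G j)"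
  shows Comp_zero_right: "Comp Q E F G j i b \<zero>\<^bsub>Hom Q E F i\<^esub> = \<zero>\<^bsub>Hom Q E G (j + i)\<^esub>"
    and Comp_minus_right: "a \<in> carrier (Hom Q E F i) \<Longrightarrow>
      Comp Q E F G j i b (\<ominus>\<^bsub>Hom Q E F i\<^esub> a) = \<ominus>\<^bsub>Hom Q E G (j + i)\<^esub> Comp Q E F G j i b a"
  using additive_zero_minus[of "Hom Q E F i" "Hom Q E G (j + i)" "Comp Q E F G j i b"] assms
  by (simp_all add: Hom_abelian_group Comp_closed Comp_add_right)

lemma
  assumes "E \<in> Ob Q" "F \<in> Ob Q" "G \<in> Ob Q" "a \<in> carrier (Hom Q E F i)"
  shows Comp_zero_left: "Comp Q E F G j i \<zero>\<^bsub>Hom Q F G j\<^esub> a = \<zero>\<^bsub>Hom Q E G (j + i)\<^esub>"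
    and Comp_minus_left: "b \<in> carrier (Hom Q F G j) \<Longrightarrow>
      Comp Q E F G j i (\<ominus>\<^bsub>Hom Q F G j\<^esub> b) a = \<ominus>\<^bsub>Hom Q E G (j + i)\<^esub> Comp Q E F G j i b a"
  using additive_zero_minus[of "Hom Q F G j" "Hom Q E G (j + i)" "\<lambda>b. Comp Q E F G j i b a"] assms
  by (simp_all add: Hom_abelian_group Comp_closed Comp_add_left)

lemma twisted_Diff_closed:
  assumes "E \<in> Ob Q" "F \<in> Ob Q" "\<eta> \<in> carrier (Hom Q E E 1)" "\<zeta> \<in> carrier (Hom Q F F 1)"
    "a \<in> carrier (Hom Q E F i)"
  shows "twisted_Diff Q E F \<eta> \<zeta> i a \<in> carrier (Hom Q E F (i + 1))"
proof -
  interpret M: abelian_group "Hom Q E F (i + 1)" using assms by (intro Hom_abelian_group)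
  show ?thesis
    using assms Diff_closed[of E F a i] Comp_closed[of E F F \<zeta> 1 a i]
      Comp_closed[of E E F a i \<eta> 1] M.abelian_group_axioms
    by (simp add: twisted_Diff_def add.commute[of 1])
qed

text \<open>
  The Leibniz rule holds for arbitrary elements of degree one, because the terms with \<open>\<zeta>\<close>, the
  element at the middle object, cancel. This generality is essential: the lifts to which the rule
  is applied do not satisfy the Maurer-Cartan equation yet. The proof names the five composites that
  occur and compares coefficients for each parity of the degrees.
\<close>

lemma twisted_Diff_Comp:
  assumes O: "E \<in> Ob Q" "F \<in> Ob Q" "G \<in> Ob Q"
    and m: "\<eta> \<in> carrier (Hom Q E E 1)" "\<zeta> \<in> carrier (Hom Q F F 1)" "\<theta> \<in> carrier (Hom Q G G 1)"
    and b: "b \<in> carrier (Hom Q F G j)" and a: "a \<in> carrier (Hom Q E F i)"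
  shows "twisted_Diff Q E G \<eta> \<theta> (j + i) (Comp Q E F G j i b a) =
      Comp Q E F G (j + 1) i (twisted_Diff Q F G \<zeta> \<theta> j b) a
        \<oplus>\<^bsub>Hom Q E G (j + i + 1)\<^esub>
      signed (Hom Q E G (j + i + 1)) j (Comp Q E F G j (i + 1) b (twisted_Diff Q E F \<eta> \<zeta> i a))"
proof -
  let ?M = "Hom Q E G (j + i + 1)"
  let ?B = "Hom Q F G (j + 1)"
  let ?A = "Hom Q E F (i + 1)"
  interpret M: abelian_group ?M using O by (intro Hom_abelian_group)
  interpret B: abelian_group ?B using O by (intro Hom_abelian_group)
  interpret A: abelian_group ?A using O by (intro Hom_abelian_group)
  have deg: "j + 1 + i = j + i + 1" "j + (i + 1) = j + i + 1" "1 + j = j + 1" "1 + i = i + 1"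
    "1 + (j + i) = j + i + 1" by simp_all
  have B: "Diff Q F G j b \<in> carrier ?B" "Comp Q F G G 1 j \<theta> b \<in> carrier ?B"
      "Comp Q F F G j 1 b \<zeta> \<in> carrier ?B"
    using O m b Diff_closed Comp_closed[of F G G \<theta> 1 b j] Comp_closed[of F F G b j \<zeta> 1]
    by (simp_all add: deg)
  have A: "Diff Q E F i a \<in> carrier ?A" "Comp Q E F F 1 i \<zeta> a \<in> carrier ?A"
      "Comp Q E E F i 1 a \<eta> \<in> carrier ?A"
    using O m a Diff_closed Comp_closed[of E F F \<zeta> 1 a i] Comp_closed[of E E F a i \<eta> 1]
    by (simp_all add: deg)
  define X1 where "X1 = Comp Q E F G (j + 1) i (Diff Q F G j b) a"
  define X2 where "X2 = Comp Q E F G j (i + 1) b (Diff Q E F i a)"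
  define X3 where "X3 = Comp Q E F G (j + 1) i (Comp Q F G G 1 j \<theta> b) a"
  define X4 where "X4 = Comp Q E F G j (i + 1) b (Comp Q E E F i 1 a \<eta>)"
  define X5 where "X5 = Comp Q E F G j (i + 1) b (Comp Q E F F 1 i \<zeta> a)"
  have X: "X1 \<in> carrier ?M" "X2 \<in> carrier ?M" "X3 \<in> carrier ?M" "X4 \<in> carrier ?M"
      "X5 \<in> carrier ?M"
    unfolding X1_def X2_def X3_def X4_def X5_def using O a b A B
      Comp_closed[OF O, of _ "j + 1" a i] Comp_closed[OF O, of b j _ "i + 1"]
    by (simp_all add: deg)
  have as: "Comp Q E G G 1 (j + i) \<theta> (Comp Q E F G j i b a) = X3"
      "Comp Q E E G (j + i) 1 (Comp Q E F G j i b a) \<eta> = X4"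
      "Comp Q E F G (j + 1) i (Comp Q F F G j 1 b \<zeta>) a = X5"
    unfolding X3_def X4_def X5_def
    using Comp_assoc[of E F G G \<theta> 1 b j a i] Comp_assoc[of E E F G b j a i \<eta> 1]
      Comp_assoc[of E F F G b j \<zeta> 1 a i] O m a b by (simp_all add: deg)
  have "twisted_Diff Q E G \<eta> \<theta> (j + i) (Comp Q E F G j i b a) =
      X1 \<oplus>\<^bsub>?M\<^esub> signed ?M j X2 \<oplus>\<^bsub>?M\<^esub> X3 \<ominus>\<^bsub>?M\<^esub> signed ?M (j + i) X4"
    unfolding twisted_Diff_def Diff_Comp[OF O b a] as X1_def X2_def by (simp add: deg)
  moreover have "Comp Q E F G (j + 1) i (twisted_Diff Q F G \<zeta> \<theta> j b) a =
      X1 \<oplus>\<^bsub>?M\<^esub> X3 \<ominus>\<^bsub>?M\<^esub> signed ?M j X5"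
    unfolding twisted_Diff_def using O a B B.abelian_group_axioms
      Comp_add_left[OF O, of _ "j + 1" _ a i] Comp_minus_left[OF O a, of _ "j + 1"]
    unfolding as(3)[symmetric]
    by (simp add: a_minus_def signed_def deg X1_def X3_def)
  moreover have "Comp Q E F G j (i + 1) b (twisted_Diff Q E F \<eta> \<zeta> i a) =
      X2 \<oplus>\<^bsub>?M\<^esub> X5 \<ominus>\<^bsub>?M\<^esub> signed ?M i X4"
    unfolding twisted_Diff_def using O b A A.abelian_group_axioms
      Comp_add_right[OF O, of b j _ "i + 1"] Comp_minus_right[OF O b, of _ "i + 1"]
    by (simp add: a_minus_def signed_def deg X2_def X4_def X5_def)
  ultimately show ?thesis
    using X by (cases "even i"; cases "even j"; simp add: signed_def; algebra)
qed

definition curvature where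
  "curvature E \<eta> = Diff Q E E 1 \<eta> \<oplus>\<^bsub>Hom Q E E 2\<^esub> Comp Q E E E 1 1 \<eta> \<eta>"

lemma curvature_closed:
  assumes "E \<in> Ob Q" "\<eta> \<in> carrier (Hom Q E E 1)"
  shows "curvature E \<eta> \<in> carrier (Hom Q E E 2)"
proof -
  interpret M: abelian_group "Hom Q E E 2" using assms by (intro Hom_abelian_group)
  show ?thesis
    using assms Diff_closed[of E E \<eta> 1] Comp_closed[of E E E \<eta> 1 \<eta> 1]
    by (simp add: curvature_def)
qed

text \<open>
  \<open>d(d\<eta> + \<eta>\<eta>) = (d\<eta>)\<eta> - \<eta>(d\<eta>)\<close> is cancelled by the commutator of \<open>\<eta>\<close> with the curvature, since
  the cubic terms agree by associativity.
\<close>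

lemma Bianchi:
  assumes E: "E \<in> Ob Q" and m: "\<eta> \<in> carrier (Hom Q E E 1)"
  shows "twisted_Diff Q E E \<eta> \<eta> 2 (curvature E \<eta>) = \<zero>\<^bsub>Hom Q E E 3\<^esub>"
proof -
  let ?M = "Hom Q E E 3"
  interpret M: abelian_group ?M using E by (intro Hom_abelian_group)
  interpret M2: abelian_group "Hom Q E E 2" using E by (intro Hom_abelian_group)
  have 2: "Diff Q E E 1 \<eta> \<in> carrier (Hom Q E E 2)" "Comp Q E E E 1 1 \<eta> \<eta> \<in> carrier (Hom Q E E 2)"
    using E m Diff_closed[of E E \<eta> 1] Comp_closed[of E E E \<eta> 1 \<eta> 1] by simp_all
  define X1 where "X1 = Comp Q E E E 2 1 (Diff Q E E 1 \<eta>) \<eta>"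
  define X2 where "X2 = Comp Q E E E 1 2 \<eta> (Diff Q E E 1 \<eta>)"
  define X3 where "X3 = Comp Q E E E 1 2 \<eta> (Comp Q E E E 1 1 \<eta> \<eta>)"
  have X: "X1 \<in> carrier ?M" "X2 \<in> carrier ?M" "X3 \<in> carrier ?M"
    using E m 2 Comp_closed[of E E E \<eta> 1 _ 2] Comp_closed[of E E E _ 2 \<eta> 1]
    by (simp_all add: X1_def X2_def X3_def)
  have "Diff Q E E 2 (curvature E \<eta>) = X1 \<ominus>\<^bsub>?M\<^esub> X2"
    using E m 2 Diff_add[OF E E 2] Diff_Diff[OF E E m] Diff_Comp[OF E E E m m] X
    by (simp add: curvature_def X1_def X2_def signed_def a_minus_def)
  moreover have "Comp Q E E E 1 2 \<eta> (curvature E \<eta>) = X2 \<oplus>\<^bsub>?M\<^esub> X3"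
    using E m 2 Comp_add_right[OF E E E m 2]
    by (simp add: curvature_def X2_def X3_def)
  moreover have "Comp Q E E E 2 1 (curvature E \<eta>) \<eta> = X1 \<oplus>\<^bsub>?M\<^esub> X3"
    using E m 2 Comp_add_left[OF E E E 2 m] Comp_assoc[OF E E E E m m m]
    by (simp add: curvature_def X1_def X3_def)
  ultimately show ?thesis
    using X by (simp add: twisted_Diff_def signed_def) algebra
qed

text \<open>
  The twisted operators are differentials only up to curvature. Degree 0 is the case of the lifted
  morphism \<open>\<alpha>\<close>, for which this measures how far \<open>D\<alpha>\<close> is from being closed.
\<close>

lemma twisted_Diff_twisted_Diff:
  assumes O: "E \<in> Ob Q" "F \<in> Ob Q"
    and m: "\<eta> \<in> carrier (Hom Q E E 1)" "\<zeta> \<in> carrier (Hom Q F F 1)"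
    and a: "a \<in> carrier (Hom Q E F 0)"
  shows "twisted_Diff Q E F \<eta> \<zeta> 1 (twisted_Diff Q E F \<eta> \<zeta> 0 a) =
    Comp Q E F F 2 0 (curvature F \<zeta>) a \<ominus>\<^bsub>Hom Q E F 2\<^esub> Comp Q E E F 0 2 a (curvature E \<eta>)"
proof -
  let ?M = "Hom Q E F 2"
  interpret M: abelian_group ?M using O by (intro Hom_abelian_group)
  interpret N: abelian_group "Hom Q E F 1" using O by (intro Hom_abelian_group)
  define d\<zeta> where "d\<zeta> = Diff Q F F 1 \<zeta>"
  define d\<eta> where "d\<eta> = Diff Q E E 1 \<eta>"
  define \<zeta>\<zeta> where "\<zeta>\<zeta> = Comp Q F F F 1 1 \<zeta> \<zeta>"
  define \<eta>\<eta> where "\<eta>\<eta> = Comp Q E E E 1 1 \<eta> \<eta>"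
  define da where "da = Diff Q E F 0 a"
  define \<zeta>a where "\<zeta>a = Comp Q E F F 1 0 \<zeta> a"
  define a\<eta> where "a\<eta> = Comp Q E E F 0 1 a \<eta>"
  have c: "d\<zeta> \<in> carrier (Hom Q F F 2)" "\<zeta>\<zeta> \<in> carrier (Hom Q F F 2)"
    "d\<eta> \<in> carrier (Hom Q E E 2)" "\<eta>\<eta> \<in> carrier (Hom Q E E 2)"
    and 1: "da \<in> carrier (Hom Q E F 1)" "\<zeta>a \<in> carrier (Hom Q E F 1)" "a\<eta> \<in> carrier (Hom Q E F 1)"
    unfolding d\<zeta>_def d\<eta>_def \<zeta>\<zeta>_def \<eta>\<eta>_def da_def \<zeta>a_def a\<eta>_def
    using O m a Diff_closed[of F F \<zeta> 1] Diff_closed[of E E \<eta> 1] Diff_closed[of E F a 0]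
      Comp_closed[of F F F \<zeta> 1 \<zeta> 1] Comp_closed[of E E E \<eta> 1 \<eta> 1] Comp_closed[of E F F \<zeta> 1 a 0]
      Comp_closed[of E E F a 0 \<eta> 1] by simp_all
  define Y1 where "Y1 = Comp Q E F F 2 0 d\<zeta> a"
  define Y2 where "Y2 = Comp Q E F F 2 0 \<zeta>\<zeta> a"
  define Y3 where "Y3 = Comp Q E E F 0 2 a d\<eta>"
  define Y4 where "Y4 = Comp Q E E F 0 2 a \<eta>\<eta>"
  define Y5 where "Y5 = Comp Q E F F 1 1 \<zeta> da"
  define Y6 where "Y6 = Comp Q E E F 1 1 da \<eta>"
  define Y7 where "Y7 = Comp Q E F F 1 1 \<zeta> a\<eta>"
  have Y: "Y1 \<in> carrier ?M" "Y2 \<in> carrier ?M" "Y3 \<in> carrier ?M" "Y4 \<in> carrier ?M"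
      "Y5 \<in> carrier ?M" "Y6 \<in> carrier ?M" "Y7 \<in> carrier ?M"
    unfolding Y1_def Y2_def Y3_def Y4_def Y5_def Y6_def Y7_def
    using O m a c 1 Comp_closed[of E F F _ 2 a 0] Comp_closed[of E E F a 0 _ 2]
      Comp_closed[of E F F \<zeta> 1 _ 1] Comp_closed[of E E F _ 1 \<eta> 1] by simp_all
  have as: "Comp Q E F F 1 1 \<zeta> \<zeta>a = Y2" "Comp Q E E F 1 1 a\<eta> \<eta> = Y4" "Comp Q E E F 1 1 \<zeta>a \<eta> = Y7"
    unfolding Y2_def Y4_def Y7_def \<zeta>\<zeta>_def \<eta>\<eta>_def \<zeta>a_def a\<eta>_def
    using Comp_assoc[of E F F F \<zeta> 1 \<zeta> 1 a 0] Comp_assoc[of E E E F a 0 \<eta> 1 \<eta> 1]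
      Comp_assoc[of E E F F \<zeta> 1 a 0 \<eta> 1] O m a by simp_all
  have tw: "twisted_Diff Q E F \<eta> \<zeta> 0 a = da \<oplus>\<^bsub>Hom Q E F 1\<^esub> \<zeta>a \<ominus>\<^bsub>Hom Q E F 1\<^esub> a\<eta>"
    by (simp add: twisted_Diff_def signed_def da_def \<zeta>a_def a\<eta>_def)
  have "Diff Q E F 1 \<zeta>a = Y1 \<ominus>\<^bsub>?M\<^esub> Y5" "Diff Q E F 1 a\<eta> = Y6 \<oplus>\<^bsub>?M\<^esub> Y3"
    "Diff Q E F 1 da = \<zero>\<^bsub>?M\<^esub>"
    using Diff_Comp[of E F F \<zeta> 1 a 0] Diff_Comp[of E E F a 0 \<eta> 1] Diff_Diff[of E F a 0] O m a
    by (simp_all add: Y1_def Y5_def Y6_def Y3_def \<zeta>a_def a\<eta>_def da_def d\<zeta>_def d\<eta>_def signed_def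
        a_minus_def)
  then have "Diff Q E F 1 (da \<oplus>\<^bsub>Hom Q E F 1\<^esub> \<zeta>a \<ominus>\<^bsub>Hom Q E F 1\<^esub> a\<eta>) =
      Y1 \<ominus>\<^bsub>?M\<^esub> Y5 \<ominus>\<^bsub>?M\<^esub> (Y6 \<oplus>\<^bsub>?M\<^esub> Y3)"
    using O 1 Y Diff_add[of E F _ 1] Diff_minus[of E F _ 1] by (simp add: a_minus_def)
  moreover have "Comp Q E F F 1 1 \<zeta> (da \<oplus>\<^bsub>Hom Q E F 1\<^esub> \<zeta>a \<ominus>\<^bsub>Hom Q E F 1\<^esub> a\<eta>) =
      Y5 \<oplus>\<^bsub>?M\<^esub> Y2 \<ominus>\<^bsub>?M\<^esub> Y7"
    using O m 1 Y Comp_add_right[of E F F \<zeta> 1 _ 1] Comp_minus_right[of E F F \<zeta> 1 _ 1]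
    by (simp add: a_minus_def as Y5_def Y7_def)
  moreover have "Comp Q E E F 1 1 (da \<oplus>\<^bsub>Hom Q E F 1\<^esub> \<zeta>a \<ominus>\<^bsub>Hom Q E F 1\<^esub> a\<eta>) \<eta> =
      Y6 \<oplus>\<^bsub>?M\<^esub> Y7 \<ominus>\<^bsub>?M\<^esub> Y4"
    using O m 1 Y Comp_add_left[of E E F _ 1 _ \<eta> 1] Comp_minus_left[of E E F \<eta> 1 _ 1]
    by (simp add: a_minus_def as Y6_def)
  moreover have "Comp Q E F F 2 0 (curvature F \<zeta>) a = Y1 \<oplus>\<^bsub>?M\<^esub> Y2"
    using O a c Comp_add_left[of E F F _ 2 _ a 0]
    by (simp add: curvature_def Y1_def Y2_def d\<zeta>_def[symmetric] \<zeta>\<zeta>_def[symmetric])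
  moreover have "Comp Q E E F 0 2 a (curvature E \<eta>) = Y3 \<oplus>\<^bsub>?M\<^esub> Y4"
    using O a c Comp_add_right[of E E F a 0 _ 2]
    by (simp add: curvature_def Y3_def Y4_def d\<eta>_def[symmetric] \<eta>\<eta>_def[symmetric])
  ultimately show ?thesis
    using Y unfolding tw twisted_Diff_def[where i = 1] by (simp add: signed_def) algebra
qed

lemma
  assumes O: "E \<in> Ob Q" "F \<in> Ob Q"
    and m: "\<eta> \<in> carrier (Hom Q E E 1)" "\<zeta> \<in> carrier (Hom Q F F 1)"
  shows twisted_Diff_add:
      "a \<in> carrier (Hom Q E F i) \<Longrightarrow> b \<in> carrier (Hom Q E F i) \<Longrightarrow>
        twisted_Diff Q E F \<eta> \<zeta> i (a \<oplus>\<^bsub>Hom Q E F i\<^esub> b) =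
          twisted_Diff Q E F \<eta> \<zeta> i a \<oplus>\<^bsub>Hom Q E F (i + 1)\<^esub> twisted_Diff Q E F \<eta> \<zeta> i b"
    and twisted_Diff_zero:
      "twisted_Diff Q E F \<eta> \<zeta> i \<zero>\<^bsub>Hom Q E F i\<^esub> = \<zero>\<^bsub>Hom Q E F (i + 1)\<^esub>"
    and twisted_Diff_minus:
      "a \<in> carrier (Hom Q E F i) \<Longrightarrow>
        twisted_Diff Q E F \<eta> \<zeta> i (\<ominus>\<^bsub>Hom Q E F i\<^esub> a) =
          \<ominus>\<^bsub>Hom Q E F (i + 1)\<^esub> twisted_Diff Q E F \<eta> \<zeta> i a"
proof -
  let ?M = "Hom Q E F (i + 1)"
  interpret M: abelian_group ?M using O by (intro Hom_abelian_group)
  have deg: "1 + i = i + 1" by simp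
  have add: "twisted_Diff Q E F \<eta> \<zeta> i (a \<oplus>\<^bsub>Hom Q E F i\<^esub> b) =
      twisted_Diff Q E F \<eta> \<zeta> i a \<oplus>\<^bsub>?M\<^esub> twisted_Diff Q E F \<eta> \<zeta> i b"
    if ab: "a \<in> carrier (Hom Q E F i)" "b \<in> carrier (Hom Q E F i)" for a b
  proof -
    have c: "Diff Q E F i c \<in> carrier ?M" "Comp Q E F F 1 i \<zeta> c \<in> carrier ?M"
      "Comp Q E E F i 1 c \<eta> \<in> carrier ?M" if "c \<in> carrier (Hom Q E F i)" for c
      using that O m Diff_closed Comp_closed[of E F F \<zeta> 1 c i] Comp_closed[of E E F c i \<eta> 1]
      by (simp_all add: deg)
    show ?thesis
      unfolding twisted_Diff_def signed_def
      using O ab m c[OF ab(1)] c[OF ab(2)] Diff_add[OF O ab]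
        Comp_add_right[OF O(1,2,2) m(2) ab] Comp_add_left[OF O(1,1,2) ab m(1)]
      by (simp add: deg) algebra
  qed
  then show "a \<in> carrier (Hom Q E F i) \<Longrightarrow> b \<in> carrier (Hom Q E F i) \<Longrightarrow>
        twisted_Diff Q E F \<eta> \<zeta> i (a \<oplus>\<^bsub>Hom Q E F i\<^esub> b) =
          twisted_Diff Q E F \<eta> \<zeta> i a \<oplus>\<^bsub>Hom Q E F (i + 1)\<^esub> twisted_Diff Q E F \<eta> \<zeta> i b" .
  show "twisted_Diff Q E F \<eta> \<zeta> i \<zero>\<^bsub>Hom Q E F i\<^esub> = \<zero>\<^bsub>?M\<^esub>"
    "a \<in> carrier (Hom Q E F i) \<Longrightarrow> twisted_Diff Q E F \<eta> \<zeta> i (\<ominus>\<^bsub>Hom Q E F i\<^esub> a) =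
      \<ominus>\<^bsub>?M\<^esub> twisted_Diff Q E F \<eta> \<zeta> i a"
    using additive_zero_minus[of "Hom Q E F i" ?M "twisted_Diff Q E F \<eta> \<zeta> i"] O m
    by (simp_all add: Hom_abelian_group add twisted_Diff_closed)
qed

text \<open>
  The linear term in \<open>u\<close> is the twisted differential; the quadratic one is what a square-zero
  extension kills.
\<close>

lemma curvature_perturbation:
  assumes E: "E \<in> Ob Q" and m: "\<eta> \<in> carrier (Hom Q E E 1)" and u: "u \<in> carrier (Hom Q E E 1)"
  shows "curvature E (\<eta> \<oplus>\<^bsub>Hom Q E E 1\<^esub> u) =
    curvature E \<eta> \<oplus>\<^bsub>Hom Q E E 2\<^esub> twisted_Diff Q E E \<eta> \<eta> 1 u
      \<oplus>\<^bsub>Hom Q E E 2\<^esub> Comp Q E E E 1 1 u u"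
proof -
  interpret M: abelian_group "Hom Q E E 2" using E by (intro Hom_abelian_group)
  interpret M1: abelian_group "Hom Q E E 1" using E by (intro Hom_abelian_group)
  note C = Comp_closed[OF E E E, of _ 1 _ 1] Diff_closed[OF E E, of _ 1]
  have c: "Comp Q E E E 1 1 x y \<in> carrier (Hom Q E E 2)" "Diff Q E E 1 x \<in> carrier (Hom Q E E 2)"
    if "x \<in> carrier (Hom Q E E 1)" "y \<in> carrier (Hom Q E E 1)" for x y
    using C that by simp_all
  show ?thesis
    unfolding curvature_def twisted_Diff_def signed_def
    using E m u c[OF m m] c[OF m u] c[OF u m] c[OF u u] Diff_add[OF E E m u]
      Comp_add_left[OF E E E m u] Comp_add_right[OF E E E m m u] Comp_add_right[OF E E E u m u]
    by simp algebra
qed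

lemma twisted_Diff_perturbation:
  assumes O: "F \<in> Ob Q" "E \<in> Ob Q"
    and m: "\<zeta> \<in> carrier (Hom Q F F 1)" "\<eta> \<in> carrier (Hom Q E E 1)"
    and u: "u \<in> carrier (Hom Q F F 1)"
    and a: "\<alpha> \<in> carrier (Hom Q F E 0)" and v: "v \<in> carrier (Hom Q F E 0)"
  shows "twisted_Diff Q F E (\<zeta> \<oplus>\<^bsub>Hom Q F F 1\<^esub> u) \<eta> 0 (\<alpha> \<oplus>\<^bsub>Hom Q F E 0\<^esub> v) =
    twisted_Diff Q F E \<zeta> \<eta> 0 \<alpha> \<oplus>\<^bsub>Hom Q F E 1\<^esub> twisted_Diff Q F E \<zeta> \<eta> 0 v
      \<ominus>\<^bsub>Hom Q F E 1\<^esub> Comp Q F F E 0 1 \<alpha> u \<ominus>\<^bsub>Hom Q F E 1\<^esub> Comp Q F F E 0 1 v u"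
proof -
  let ?M = "Hom Q F E 1"
  interpret M: abelian_group ?M using O by (intro Hom_abelian_group)
  interpret M0: abelian_group "Hom Q F E 0" using O by (intro Hom_abelian_group)
  interpret M1: abelian_group "Hom Q F F 1" using O by (intro Hom_abelian_group)
  let ?w = "\<alpha> \<oplus>\<^bsub>Hom Q F E 0\<^esub> v"
  have w: "?w \<in> carrier (Hom Q F E 0)" using a v by simp
  have c: "Comp Q F F E 0 1 x y \<in> carrier ?M" "Diff Q F E 0 x \<in> carrier ?M"
    "Comp Q F E E 1 0 \<eta> x \<in> carrier ?M"
    if "x \<in> carrier (Hom Q F E 0)" "y \<in> carrier (Hom Q F F 1)" for x y
    using that O m Comp_closed[of F F E x 0 y 1] Comp_closed[of F E E \<eta> 1 x 0]
      Diff_closed[of F E x 0] by simp_all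
  have "twisted_Diff Q F E (\<zeta> \<oplus>\<^bsub>Hom Q F F 1\<^esub> u) \<eta> 0 ?w =
      twisted_Diff Q F E \<zeta> \<eta> 0 ?w \<ominus>\<^bsub>?M\<^esub> Comp Q F F E 0 1 ?w u"
    unfolding twisted_Diff_def signed_def
    using O m u w Comp_add_right[OF O(1,1,2) w m(1) u] c[OF w m(1)] c[OF w u] by simp algebra
  also have "Comp Q F F E 0 1 ?w u = Comp Q F F E 0 1 \<alpha> u \<oplus>\<^bsub>?M\<^esub> Comp Q F F E 0 1 v u"
    using Comp_add_left[OF O(1,1,2) a v u] by simp
  also have "twisted_Diff Q F E \<zeta> \<eta> 0 ?w =
      twisted_Diff Q F E \<zeta> \<eta> 0 \<alpha> \<oplus>\<^bsub>?M\<^esub> twisted_Diff Q F E \<zeta> \<eta> 0 v"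
    using twisted_Diff_add[OF O m a v] by simp
  finally show ?thesis
    using O m u c[OF a u] c[OF v u] twisted_Diff_closed[OF O m a] twisted_Diff_closed[OF O m v] a v
    by simp algebra
qed

end

section \<open>Isomorphisms in the zeroth cohomology\<close>

text \<open>
  Composition of classes is defined by uniting over all representatives. Since \<open>f\<close> and \<open>g\<close> belong to
  their own classes (zero being exact), \<open>gf\<close> belongs to the composite class, hence to the class of
  the identity.
\<close>

lemma (in dg_category) H0_inverse_homotopy:
  assumes O: "E \<in> Ob Q" "F \<in> Ob Q"
    and m: "\<eta> \<in> carrier (Hom Q E E 1)" "\<zeta> \<in> carrier (Hom Q F F 1)"
    and f: "f \<in> carrier (Hom Q E F 0)" and g: "g \<in> carrier (Hom Q F E 0)"
    and inv: "cat_Comp (H0 (MC Q)) (E, \<eta>) (F, \<zeta>) (E, \<eta>)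
      (H0_class (MC Q) (F, \<zeta>) (E, \<eta>) g) (H0_class (MC Q) (E, \<eta>) (F, \<zeta>) f) =
      cat_Ident (H0 (MC Q)) (E, \<eta>)"
  shows "\<exists>h\<in>carrier (Hom Q E E (-1)). Comp Q E F E 0 0 g f =
    twisted_Diff Q E E \<eta> \<eta> (-1) h \<oplus>\<^bsub>Hom Q E E 0\<^esub> Ident Q E"
proof -
  have self: "x \<in> H0_class (MC Q) (E', \<chi>) (F', \<psi>) x"
    if "E' \<in> Ob Q" "F' \<in> Ob Q" "\<chi> \<in> carrier (Hom Q E' E' 1)" "\<psi> \<in> carrier (Hom Q F' F' 1)"
      "x \<in> carrier (Hom Q E' F' 0)" for E' F' \<chi> \<psi> x
  proof -
    interpret M: abelian_group "Hom Q E' F' 0" using that by (intro Hom_abelian_group)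
    interpret N: abelian_group "Hom Q E' F' (-1)" using that by (intro Hom_abelian_group)
    have "\<zero>\<^bsub>Hom Q E' F' 0\<^esub> \<in> exact0 (MC Q) (E', \<chi>) (F', \<psi>)"
      unfolding exact0_def using twisted_Diff_zero[OF that(1-4), of "-1"]
      by (auto simp: MC_def intro!: image_eqI[of _ _ "\<zero>\<^bsub>Hom Q E' F' (-1)\<^esub>"])
    then show ?thesis
      unfolding H0_class_def a_r_coset_def r_coset_def using that(5)
      by (auto simp: MC_def intro!: bexI[of _ "\<zero>\<^bsub>Hom Q E' F' 0\<^esub>"])
  qed
  have "Comp Q E F E 0 0 g f \<in> H0_class (MC Q) (E, \<eta>) (E, \<eta>) (Comp Q E F E 0 0 g f)"
    using Comp_closed[OF O(1,2,1) g f] by (intro self O m) simp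
  then have "Comp Q E F E 0 0 g f \<in> cat_Comp (H0 (MC Q)) (E, \<eta>) (F, \<zeta>) (E, \<eta>)
      (H0_class (MC Q) (F, \<zeta>) (E, \<eta>) g) (H0_class (MC Q) (E, \<eta>) (F, \<zeta>) f)"
    using self[OF O m f] self[OF O(2,1) m(2,1) g] by (auto simp: H0_def MC_def)
  then have "Comp Q E F E 0 0 g f \<in> H0_class (MC Q) (E, \<eta>) (E, \<eta>) (Ident Q E)"
    unfolding inv by (simp add: H0_def MC_def)
  then show ?thesis
    unfolding H0_class_def a_r_coset_def r_coset_def exact0_def by (auto simp: MC_def)
qed

section \<open>Square-zero extensions of dg-categories\<close>

locale square_zero_extension = Q: dg_category R Q + Q': dg_category R' Q'
  for R :: "('r, 'x) ring_scheme" and Q :: "('o, 'r, 'm) dgcat"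
    and R' :: "('s, 'y) ring_scheme" and Q' :: "('o, 's, 'n) dgcat" +
  fixes p :: "'o \<Rightarrow> 'o \<Rightarrow> int \<Rightarrow> 'm \<Rightarrow> 'n"
  assumes Ob_eq: "Ob Q' = Ob Q"
    and p_closed: "\<lbrakk> E \<in> Ob Q; F \<in> Ob Q; a \<in> carrier (Hom Q E F i) \<rbrakk> \<Longrightarrow>
      p E F i a \<in> carrier (Hom Q' E F i)"
    and p_add: "\<lbrakk> E \<in> Ob Q; F \<in> Ob Q; a \<in> carrier (Hom Q E F i); b \<in> carrier (Hom Q E F i) \<rbrakk> \<Longrightarrow>
      p E F i (a \<oplus>\<^bsub>Hom Q E F i\<^esub> b) = p E F i a \<oplus>\<^bsub>Hom Q' E F i\<^esub> p E F i b"
    and p_surj: "\<lbrakk> E \<in> Ob Q; F \<in> Ob Q; a' \<in> carrier (Hom Q' E F i) \<rbrakk> \<Longrightarrow>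
      \<exists>a\<in>carrier (Hom Q E F i). p E F i a = a'"
    and p_Diff: "\<lbrakk> E \<in> Ob Q; F \<in> Ob Q; a \<in> carrier (Hom Q E F i) \<rbrakk> \<Longrightarrow>
      p E F (i + 1) (Diff Q E F i a) = Diff Q' E F i (p E F i a)"
    and p_Comp: "\<lbrakk> E \<in> Ob Q; F \<in> Ob Q; G \<in> Ob Q; b \<in> carrier (Hom Q F G j);
        a \<in> carrier (Hom Q E F i) \<rbrakk> \<Longrightarrow>
      p E G (j + i) (Comp Q E F G j i b a) = Comp Q' E F G j i (p F G j b) (p E F i a)"
    and p_Ident: "E \<in> Ob Q \<Longrightarrow> p E E 0 (Ident Q E) = Ident Q' E"
    and square_zero: "\<lbrakk> E \<in> Ob Q; F \<in> Ob Q; G \<in> Ob Q; b \<in> carrier (Hom Q F G j);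
        a \<in> carrier (Hom Q E F i); p F G j b = \<zero>\<^bsub>Hom Q' F G j\<^esub>; p E F i a = \<zero>\<^bsub>Hom Q' E F i\<^esub> \<rbrakk> \<Longrightarrow>
      Comp Q E F G j i b a = \<zero>\<^bsub>Hom Q E G (j + i)\<^esub>"
begin

definition ker where
  "ker E F i = {x \<in> carrier (Hom Q E F i). p E F i x = \<zero>\<^bsub>Hom Q' E F i\<^esub>}"

lemma ker_closed: "x \<in> ker E F i \<Longrightarrow> x \<in> carrier (Hom Q E F i)"
  by (simp add: ker_def)

lemma Hom'_abelian_group: "E \<in> Ob Q \<Longrightarrow> F \<in> Ob Q \<Longrightarrow> abelian_group (Hom Q' E F i)"
  using Q'.Hom_abelian_group Ob_eq by simp

lemma p_minus:
  assumes "E \<in> Ob Q" "F \<in> Ob Q" "a \<in> carrier (Hom Q E F i)"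
  shows "p E F i (\<ominus>\<^bsub>Hom Q E F i\<^esub> a) = \<ominus>\<^bsub>Hom Q' E F i\<^esub> p E F i a"
  using additive_zero_minus[of "Hom Q E F i" "Hom Q' E F i" "p E F i"] assms
  by (simp add: Q.Hom_abelian_group Hom'_abelian_group p_closed p_add)

lemma p_twisted_Diff:
  assumes O: "E \<in> Ob Q" "F \<in> Ob Q"
    and m: "\<eta> \<in> carrier (Hom Q E E 1)" "\<zeta> \<in> carrier (Hom Q F F 1)"
    and a: "a \<in> carrier (Hom Q E F i)"
  shows "p E F (i + 1) (twisted_Diff Q E F \<eta> \<zeta> i a) =
    twisted_Diff Q' E F (p E E 1 \<eta>) (p F F 1 \<zeta>) i (p E F i a)"
proof -
  interpret M: abelian_group "Hom Q E F (i + 1)" using O by (intro Q.Hom_abelian_group)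
  have deg: "1 + i = i + 1" by simp
  show ?thesis
    unfolding twisted_Diff_def signed_def a_minus_def
    using O m a Q.Diff_closed Q.Comp_closed[of E F F \<zeta> 1 a i] Q.Comp_closed[of E E F a i \<eta> 1]
      p_Comp[of E F F \<zeta> 1 a i] p_Comp[of E E F a i \<eta> 1] p_Diff[of E F a i]
    by (simp add: deg p_add p_minus)
qed

lemma p_curvature:
  assumes E: "E \<in> Ob Q" and m: "\<eta> \<in> carrier (Hom Q E E 1)"
  shows "p E E 2 (Q.curvature E \<eta>) = Q'.curvature E (p E E 1 \<eta>)"
  unfolding Q.curvature_def Q'.curvature_def
  using E m Q.Diff_closed[of E E \<eta> 1] Q.Comp_closed[of E E E \<eta> 1 \<eta> 1]
    p_Comp[of E E E \<eta> 1 \<eta> 1] p_Diff[of E E \<eta> 1]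
  by (simp add: p_add)

lemma
  assumes O: "E \<in> Ob Q" "F \<in> Ob Q" and x: "x \<in> ker E F i"
  shows ker_add: "y \<in> ker E F i \<Longrightarrow> x \<oplus>\<^bsub>Hom Q E F i\<^esub> y \<in> ker E F i"
    and ker_minus: "\<ominus>\<^bsub>Hom Q E F i\<^esub> x \<in> ker E F i"
proof -
  interpret M: abelian_group "Hom Q E F i" using O by (intro Q.Hom_abelian_group)
  interpret M': abelian_group "Hom Q' E F i" using O by (intro Hom'_abelian_group)
  show "y \<in> ker E F i \<Longrightarrow> x \<oplus>\<^bsub>Hom Q E F i\<^esub> y \<in> ker E F i"
    "\<ominus>\<^bsub>Hom Q E F i\<^esub> x \<in> ker E F i"
    using O x by (simp_all add: ker_def p_add p_minus)
qed

lemma ker_Comp: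
  assumes O: "E \<in> Ob Q" "F \<in> Ob Q" "G \<in> Ob Q"
    and b: "b \<in> carrier (Hom Q F G j)" and x: "x \<in> ker E F i"
  shows "Comp Q E F G j i b x \<in> ker E G (j + i)"
  using O b x
  by (simp add: ker_def p_Comp p_closed Q.Comp_closed Q'.Comp_zero_right Ob_eq)

lemma ker_Comp_ker:
  assumes "E \<in> Ob Q" "F \<in> Ob Q" "G \<in> Ob Q" "b \<in> ker F G j" "x \<in> ker E F i"
  shows "Comp Q E F G j i b x = \<zero>\<^bsub>Hom Q E G (j + i)\<^esub>"
  using assms unfolding ker_def by (intro square_zero) auto

text \<open>
  Because kernel elements compose to zero, the kernel is a module over \<open>Q'\<close>: the action of \<open>b\<close> on
  it depends only on the reduction of \<open>b\<close>. Relations known only in \<open>Q'\<close> can thus be used in \<open>Q\<close>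
  when they act on the kernel.
\<close>

lemma ker_Comp_cong:
  assumes O: "E \<in> Ob Q" "F \<in> Ob Q" "G \<in> Ob Q"
    and b: "b \<in> carrier (Hom Q F G j)" "c \<in> carrier (Hom Q F G j)" "p F G j b = p F G j c"
    and x: "x \<in> ker E F i"
  shows "Comp Q E F G j i b x = Comp Q E F G j i c x"
proof -
  interpret M: abelian_group "Hom Q F G j" using O by (intro Q.Hom_abelian_group)
  interpret M': abelian_group "Hom Q' F G j" using O by (intro Hom'_abelian_group)
  interpret N: abelian_group "Hom Q E G (j + i)" using O by (intro Q.Hom_abelian_group)
  let ?d = "b \<ominus>\<^bsub>Hom Q F G j\<^esub> c"
  have "?d \<in> ker F G j"
    using O b p_closed[of F G c j] by (simp add: ker_def a_minus_def p_add p_minus M'.r_neg)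
  then have "Comp Q E F G j i ?d x = \<zero>\<^bsub>Hom Q E G (j + i)\<^esub>" "?d \<in> carrier (Hom Q F G j)"
    using ker_Comp_ker O x by (auto intro: ker_closed)
  moreover have "b = c \<oplus>\<^bsub>Hom Q F G j\<^esub> ?d" using b by algebra
  ultimately show ?thesis
    using O b x Q.Comp_add_left[OF O b(2), of ?d x i] Q.Comp_closed[OF O b(2), of x i] ker_closed[OF x]
    by simp
qed

lemma ker_twisted_Diff:
  assumes O: "E \<in> Ob Q" "F \<in> Ob Q"
    and m: "\<eta> \<in> carrier (Hom Q E E 1)" "\<zeta> \<in> carrier (Hom Q F F 1)"
    and x: "x \<in> ker E F i"
  shows "twisted_Diff Q E F \<eta> \<zeta> i x \<in> ker E F (i + 1)"
  using O m x Q'.twisted_Diff_zero[of E F "p E E 1 \<eta>" "p F F 1 \<zeta>" i]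
  by (simp add: ker_def Q.twisted_Diff_closed p_twisted_Diff p_closed Ob_eq)

text \<open>
  A morphism that is closed modulo the kernel acts on the kernel by a chain map.
\<close>

lemma twisted_Diff_Comp_cocycle:
  assumes O: "E \<in> Ob Q" "F \<in> Ob Q" "G \<in> Ob Q"
    and m: "\<eta> \<in> carrier (Hom Q E E 1)" "\<zeta> \<in> carrier (Hom Q F F 1)" "\<theta> \<in> carrier (Hom Q G G 1)"
    and b: "b \<in> carrier (Hom Q F G 0)" "twisted_Diff Q F G \<zeta> \<theta> 0 b \<in> ker F G 1"
    and x: "x \<in> ker E F i"
  shows "twisted_Diff Q E G \<eta> \<theta> i (Comp Q E F G 0 i b x) =
    Comp Q E F G 0 (i + 1) b (twisted_Diff Q E F \<eta> \<zeta> i x)"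
proof -
  interpret M: abelian_group "Hom Q E G (i + 1)" using O by (intro Q.Hom_abelian_group)
  note x' = ker_closed[OF x]
  have "Comp Q E F G 1 i (twisted_Diff Q F G \<zeta> \<theta> 0 b) x = \<zero>\<^bsub>Hom Q E G (1 + i)\<^esub>"
    using ker_Comp_ker[OF O b(2) x] .
  moreover have "Comp Q E F G 0 (i + 1) b (twisted_Diff Q E F \<eta> \<zeta> i x) \<in> carrier (Hom Q E G (i + 1))"
    using Q.Comp_closed[OF O b(1) Q.twisted_Diff_closed[OF O(1,2) m(1,2) x']] by simp
  ultimately show ?thesis
    using Q.twisted_Diff_Comp[OF O m b(1) x'] by (simp add: signed_def add.commute[of 1 i])
qed

text \<open>
  The indices are shifted so that \<open>h\<close>, of degree \<open>-1\<close>, maps degree \<open>i + 1\<close> to degree \<open>i\<close>.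
\<close>

lemma twisted_Diff_homotopy_Comp:
  assumes O: "E \<in> Ob Q" "F \<in> Ob Q" "G \<in> Ob Q"
    and m: "\<eta> \<in> carrier (Hom Q E E 1)" "\<zeta> \<in> carrier (Hom Q F F 1)" "\<theta> \<in> carrier (Hom Q G G 1)"
    and h: "h \<in> carrier (Hom Q F G (-1))"
    and x: "x \<in> carrier (Hom Q E F (i + 1))" "twisted_Diff Q E F \<eta> \<zeta> (i + 1) x = \<zero>\<^bsub>Hom Q E F (i + 2)\<^esub>"
  shows "twisted_Diff Q E G \<eta> \<theta> i (Comp Q E F G (-1) (i + 1) h x) =
    Comp Q E F G 0 (i + 1) (twisted_Diff Q F G \<zeta> \<theta> (-1) h) x"
proof -
  interpret M: abelian_group "Hom Q E G (i + 1)" using O by (intro Q.Hom_abelian_group)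
  have "Comp Q E F G 0 (i + 1) (twisted_Diff Q F G \<zeta> \<theta> (-1) h) x \<in> carrier (Hom Q E G (i + 1))"
    using Q.Comp_closed[OF O Q.twisted_Diff_closed[OF O(2,3) m(2,3) h] x(1)] by simp
  then show ?thesis
    using Q.twisted_Diff_Comp[OF O m h x(1)] Q.Comp_zero_right[OF O h, of "i + 2"] x(2)
    by (simp add: signed_def add.assoc add.commute[of 1 i])
qed

text \<open>
  Here \<open>e\<close> is a coboundary in the application, so \<open>b\<close> and \<open>c\<close> act on the kernel as inverses up to
  homotopy.
\<close>

lemma Comp_homotopic_to_Ident:
  assumes O: "E \<in> Ob Q" "F \<in> Ob Q" "G \<in> Ob Q"
    and b: "b \<in> carrier (Hom Q G F 0)" and c: "c \<in> carrier (Hom Q F G 0)"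
    and e: "e \<in> carrier (Hom Q F F 0)"
    and eq: "Comp Q' F G F 0 0 (p G F 0 b) (p F G 0 c) = p F F 0 e \<oplus>\<^bsub>Hom Q' F F 0\<^esub> Ident Q' F"
    and x: "x \<in> ker E F i"
  shows "Comp Q E G F 0 i b (Comp Q E F G 0 i c x) =
    Comp Q E F F 0 i e x \<oplus>\<^bsub>Hom Q E F i\<^esub> x"
proof -
  interpret M: abelian_group "Hom Q F F 0" using O by (intro Q.Hom_abelian_group)
  note x' = ker_closed[OF x] and I = Q.Ident_closed[OF O(2)]
  have "Comp Q E G F 0 i b (Comp Q E F G 0 i c x) = Comp Q E F F 0 i (Comp Q F G F 0 0 b c) x"
    using Q.Comp_assoc[OF O(1,2,3,2) b c x'] by simp
  also have "\<dots> = Comp Q E F F 0 i (e \<oplus>\<^bsub>Hom Q F F 0\<^esub> Ident Q F) x"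
    using O b c e x I eq p_Comp[OF O(2,3,2) b c] Q.Comp_closed[OF O(2,3,2) b c]
    by (intro ker_Comp_cong) (simp_all add: p_add p_Ident)
  also have "\<dots> = Comp Q E F F 0 i e x \<oplus>\<^bsub>Hom Q E F i\<^esub> x"
    using Q.Comp_add_left[OF O(1,2,2) e I x'] Q.Comp_Ident_left[OF O(1,2) x'] by simp
  finally show ?thesis .
qed

text \<open>
  The explicit form of the statement that the cone of a homotopy equivalence is acyclic, applied to
  the kernel of \<open>p\<close>. The choice of \<open>u\<^sub>0\<close> reflects that \<open>\<alpha>\<close> is injective on cohomology: as \<open>\<alpha>\<kappa>\<close> is
  exact, so is \<open>\<kappa>\<close>. The correction by \<open>ay\<close> reflects that it is surjective: the closed element \<open>y\<close>,
  the error left by \<open>u\<^sub>0\<close> in the second equation, is the image of \<open>ay\<close> up to a coboundary.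
\<close>

theorem homotopy_equivalence_lifts:
  assumes E: "E \<in> Ob Q" and F: "F \<in> Ob Q"
    and \<eta>: "\<eta> \<in> carrier (Hom Q E E 1)" "Q.curvature E \<eta> = \<zero>\<^bsub>Hom Q E E 2\<^esub>"
    and \<zeta>': "\<zeta>' \<in> carrier (Hom Q' F F 1)" "Q'.curvature F \<zeta>' = \<zero>\<^bsub>Hom Q' F F 2\<^esub>"
    and \<alpha>': "\<alpha>' \<in> carrier (Hom Q' F E 0)"
      "twisted_Diff Q' F E \<zeta>' (p E E 1 \<eta>) 0 \<alpha>' = \<zero>\<^bsub>Hom Q' F E 1\<^esub>"
    and a': "a' \<in> carrier (Hom Q' E F 0)"
      "twisted_Diff Q' E F (p E E 1 \<eta>) \<zeta>' 0 a' = \<zero>\<^bsub>Hom Q' E F 1\<^esub>"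
    and g': "g' \<in> carrier (Hom Q' F F (-1))" "Comp Q' F E F 0 0 a' \<alpha>' =
      twisted_Diff Q' F F \<zeta>' \<zeta>' (-1) g' \<oplus>\<^bsub>Hom Q' F F 0\<^esub> Ident Q' F"
    and h': "h' \<in> carrier (Hom Q' E E (-1))" "Comp Q' E F E 0 0 \<alpha>' a' =
      twisted_Diff Q' E E (p E E 1 \<eta>) (p E E 1 \<eta>) (-1) h' \<oplus>\<^bsub>Hom Q' E E 0\<^esub> Ident Q' E"
  shows "\<exists>\<zeta>\<in>carrier (Hom Q F F 1). \<exists>\<alpha>\<in>carrier (Hom Q F E 0).
    p F F 1 \<zeta> = \<zeta>' \<and> p F E 0 \<alpha> = \<alpha>' \<and>
    Q.curvature F \<zeta> = \<zero>\<^bsub>Hom Q F F 2\<^esub> \<and> twisted_Diff Q F E \<zeta> \<eta> 0 \<alpha> = \<zero>\<^bsub>Hom Q F E 1\<^esub>"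
proof -
  interpret F1: abelian_group "Hom Q F F 1" using F by (intro Q.Hom_abelian_group)
  interpret F2: abelian_group "Hom Q F F 2" using F by (intro Q.Hom_abelian_group)
  interpret F3: abelian_group "Hom Q F F 3" using F by (intro Q.Hom_abelian_group)
  interpret FE0: abelian_group "Hom Q F E 0" using E F by (intro Q.Hom_abelian_group)
  interpret FE1: abelian_group "Hom Q F E 1" using E F by (intro Q.Hom_abelian_group)
  interpret FE2: abelian_group "Hom Q F E 2" using E F by (intro Q.Hom_abelian_group)
  interpret F1': abelian_group "Hom Q' F F 1" using F by (intro Hom'_abelian_group)
  interpret FE0': abelian_group "Hom Q' F E 0" using E F by (intro Hom'_abelian_group)
  obtain \<zeta> where \<zeta>: "\<zeta> \<in> carrier (Hom Q F F 1)" "p F F 1 \<zeta> = \<zeta>'"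
    using p_surj[OF F F \<zeta>'(1)] by blast
  obtain \<alpha> where \<alpha>: "\<alpha> \<in> carrier (Hom Q F E 0)" "p F E 0 \<alpha> = \<alpha>'"
    using p_surj[OF F E \<alpha>'(1)] by blast
  obtain a where a: "a \<in> carrier (Hom Q E F 0)" "p E F 0 a = a'"
    using p_surj[OF E F a'(1)] by blast
  obtain g where g: "g \<in> carrier (Hom Q F F (-1))" "p F F (-1) g = g'"
    using p_surj[OF F F g'(1)] by blast
  obtain h where h: "h \<in> carrier (Hom Q E E (-1))" "p E E (-1) h = h'"
    using p_surj[OF E E h'(1)] by blast
  define \<kappa> where "\<kappa> = Q.curvature F \<zeta>"
  define \<nu> where "\<nu> = twisted_Diff Q F E \<zeta> \<eta> 0 \<alpha>"
  let ?DF = "twisted_Diff Q F F \<zeta> \<zeta>" and ?DFE = "twisted_Diff Q F E \<zeta> \<eta>"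
  have \<kappa>: "\<kappa> \<in> ker F F 2"
    using F \<zeta> \<zeta>' by (simp add: \<kappa>_def ker_def p_curvature Q.curvature_closed)
  have \<nu>: "\<nu> \<in> ker F E 1"
    using p_twisted_Diff[OF F E \<zeta>(1) \<eta>(1) \<alpha>(1)] Q.twisted_Diff_closed[OF F E \<zeta>(1) \<eta>(1) \<alpha>(1)]
      \<zeta>(2) \<alpha>(2) \<alpha>'(2) by (simp add: \<nu>_def ker_def)
  have Da: "twisted_Diff Q E F \<eta> \<zeta> 0 a \<in> ker E F 1"
    using p_twisted_Diff[OF E F \<eta>(1) \<zeta>(1) a(1)] Q.twisted_Diff_closed[OF E F \<eta>(1) \<zeta>(1) a(1)]
      \<zeta>(2) a(2) a'(2) by (simp add: ker_def)
  have D\<kappa>: "?DF 2 \<kappa> = \<zero>\<^bsub>Hom Q F F 3\<^esub>"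
    unfolding \<kappa>_def using Q.Bianchi[OF F \<zeta>(1)] .
  have \<alpha>\<kappa>: "Comp Q F F E 0 2 \<alpha> \<kappa> \<in> ker F E 2"
    using ker_Comp[OF F F E \<alpha>(1) \<kappa>] by simp
  have D\<nu>: "?DFE 1 \<nu> = \<ominus>\<^bsub>Hom Q F E 2\<^esub> Comp Q F F E 0 2 \<alpha> \<kappa>"
    using Q.twisted_Diff_twisted_Diff[OF F E \<zeta>(1) \<eta>(1) \<alpha>(1)] \<eta>(2) ker_closed[OF \<alpha>\<kappa>]
      Q.Comp_zero_left[OF F E E \<alpha>(1), of 2]
    by (simp add: \<nu>_def \<kappa>_def a_minus_def)
  let ?Dg = "?DF (-1) g" and ?Dh = "twisted_Diff Q E E \<eta> \<eta> (-1) h"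
  have Dg: "?Dg \<in> carrier (Hom Q F F 0)" and Dh: "?Dh \<in> carrier (Hom Q E E 0)"
    using Q.twisted_Diff_closed[OF F F \<zeta>(1) \<zeta>(1) g(1)] Q.twisted_Diff_closed[OF E E \<eta>(1) \<eta>(1) h(1)]
    by simp_all
  have a\<alpha>: "Comp Q F E F 0 i a (Comp Q F F E 0 i \<alpha> x) = Comp Q F F F 0 i ?Dg x \<oplus>\<^bsub>Hom Q F F i\<^esub> x"
    if "x \<in> ker F F i" for x i
    using p_twisted_Diff[OF F F \<zeta>(1) \<zeta>(1) g(1)] g(2) g'(2) \<alpha>(2) a(2) \<zeta>(2)
    by (intro Comp_homotopic_to_Ident F E a(1) \<alpha>(1) Dg that) simp
  have \<alpha>a: "Comp Q F F E 0 i \<alpha> (Comp Q F E F 0 i a x) = Comp Q F E E 0 i ?Dh x \<oplus>\<^bsub>Hom Q F E i\<^esub> x"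
    if "x \<in> ker F E i" for x i
    using p_twisted_Diff[OF E E \<eta>(1) \<eta>(1) h(1)] h(2) h'(2) \<alpha>(2) a(2)
    by (intro Comp_homotopic_to_Ident F E a(1) \<alpha>(1) Dh that) simp

  \<comment> \<open>Solve \<open>Du = -\<kappa>\<close>, using \<open>\<kappa> = a\<alpha>\<kappa> - (Dg)\<kappa>\<close> and \<open>\<alpha>\<kappa> = -D\<nu>\<close>.\<close>
  define u\<^sub>0 where "u\<^sub>0 = Comp Q F E F 0 1 a \<nu> \<oplus>\<^bsub>Hom Q F F 1\<^esub> Comp Q F F F (-1) 2 g \<kappa>"
  have a\<nu>: "Comp Q F E F 0 1 a \<nu> \<in> ker F F 1" and g\<kappa>: "Comp Q F F F (-1) 2 g \<kappa> \<in> ker F F 1"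
    using ker_Comp[OF F E F a(1) \<nu>] ker_Comp[OF F F F g(1) \<kappa>] by simp_all
  have u\<^sub>0: "u\<^sub>0 \<in> ker F F 1"
    unfolding u\<^sub>0_def by (rule ker_add[OF F F a\<nu> g\<kappa>])
  have Du\<^sub>0: "?DF 1 u\<^sub>0 = \<ominus>\<^bsub>Hom Q F F 2\<^esub> \<kappa>"
  proof -
    have "Comp Q F F F 0 2 ?Dg \<kappa> \<in> carrier (Hom Q F F 2)"
      using Q.Comp_closed[OF F F F Dg ker_closed[OF \<kappa>]] by simp
    moreover have "?DF 1 (Comp Q F E F 0 1 a \<nu>) =
        \<ominus>\<^bsub>Hom Q F F 2\<^esub> (Comp Q F F F 0 2 ?Dg \<kappa> \<oplus>\<^bsub>Hom Q F F 2\<^esub> \<kappa>)"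
      using twisted_Diff_Comp_cocycle[OF F E F \<zeta>(1) \<eta>(1) \<zeta>(1) a(1) Da \<nu>] D\<nu> a\<alpha>[OF \<kappa>]
        Q.Comp_minus_right[OF F E F a(1) ker_closed[OF \<alpha>\<kappa>]] by simp
    moreover have "?DF 1 (Comp Q F F F (-1) 2 g \<kappa>) = Comp Q F F F 0 2 ?Dg \<kappa>"
      using twisted_Diff_homotopy_Comp[OF F F F \<zeta>(1) \<zeta>(1) \<zeta>(1) g(1), of \<kappa> 1] ker_closed[OF \<kappa>] D\<kappa>
      by simp
    ultimately show ?thesis
      unfolding u\<^sub>0_def
      using Q.twisted_Diff_add[OF F F \<zeta>(1) \<zeta>(1) ker_closed[OF a\<nu>] ker_closed[OF g\<kappa>]] ker_closed[OF \<kappa>]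
      by simp algebra
  qed

  \<comment> \<open>The error in the second equation; it is closed because \<open>D(\<alpha>u\<^sub>0) = -\<alpha>\<kappa> = D\<nu>\<close>.\<close>
  define y where "y = Comp Q F F E 0 1 \<alpha> u\<^sub>0 \<ominus>\<^bsub>Hom Q F E 1\<^esub> \<nu>"
  have \<alpha>u\<^sub>0: "Comp Q F F E 0 1 \<alpha> u\<^sub>0 \<in> ker F E 1"
    using ker_Comp[OF F F E \<alpha>(1) u\<^sub>0] by simp
  have y: "y \<in> ker F E 1"
    unfolding y_def a_minus_def by (intro ker_add F E \<alpha>u\<^sub>0 ker_minus \<nu>)
  have Dy: "?DFE 1 y = \<zero>\<^bsub>Hom Q F E 2\<^esub>"
  proof -
    have "\<nu> = ?DFE 0 \<alpha>" by (simp add: \<nu>_def)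
    then have "?DFE 1 (Comp Q F F E 0 1 \<alpha> u\<^sub>0) = \<ominus>\<^bsub>Hom Q F E 2\<^esub> Comp Q F F E 0 2 \<alpha> \<kappa>"
      using twisted_Diff_Comp_cocycle[OF F F E \<zeta>(1) \<zeta>(1) \<eta>(1) \<alpha>(1) _ u\<^sub>0] \<nu> Du\<^sub>0
        Q.Comp_minus_right[OF F F E \<alpha>(1) ker_closed[OF \<kappa>]] by simp
    then show ?thesis
      unfolding y_def a_minus_def
      using Q.twisted_Diff_add[OF F E \<zeta>(1) \<eta>(1) ker_closed[OF \<alpha>u\<^sub>0] FE1.a_inv_closed[OF ker_closed[OF \<nu>]]]
        Q.twisted_Diff_minus[OF F E \<zeta>(1) \<eta>(1) ker_closed[OF \<nu>]] D\<nu> ker_closed[OF \<alpha>\<kappa>]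
      by (simp add: FE2.l_neg)
  qed

  \<comment> \<open>Correct \<open>u\<^sub>0\<close> by the closed element \<open>ay\<close>, for which \<open>\<alpha>ay = y + D(hy)\<close>.\<close>
  define u where "u = u\<^sub>0 \<ominus>\<^bsub>Hom Q F F 1\<^esub> Comp Q F E F 0 1 a y"
  define v where "v = \<ominus>\<^bsub>Hom Q F E 0\<^esub> Comp Q F E E (-1) 1 h y"
  have ay: "Comp Q F E F 0 1 a y \<in> ker F F 1" and hy: "Comp Q F E E (-1) 1 h y \<in> ker F E 0"
    using ker_Comp[OF F E F a(1) y] ker_Comp[OF F E E h(1) y] by simp_all
  have u: "u \<in> ker F F 1"
    unfolding u_def a_minus_def by (intro ker_add F u\<^sub>0 ker_minus ay)
  have v: "v \<in> ker F E 0"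
    unfolding v_def by (intro F E ker_minus hy)
  have Du: "?DF 1 u = \<ominus>\<^bsub>Hom Q F F 2\<^esub> \<kappa>"
  proof -
    have "?DF 1 (Comp Q F E F 0 1 a y) = \<zero>\<^bsub>Hom Q F F 2\<^esub>"
      using twisted_Diff_Comp_cocycle[OF F E F \<zeta>(1) \<eta>(1) \<zeta>(1) a(1) Da y] Dy
        Q.Comp_zero_right[OF F E F a(1), of 2] by simp
    then show ?thesis
      unfolding u_def a_minus_def
      using Q.twisted_Diff_add[OF F F \<zeta>(1) \<zeta>(1) ker_closed[OF u\<^sub>0] F1.a_inv_closed[OF ker_closed[OF ay]]]
        Q.twisted_Diff_minus[OF F F \<zeta>(1) \<zeta>(1) ker_closed[OF ay]] Du\<^sub>0 ker_closed[OF \<kappa>]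
      by simp
  qed
  have \<alpha>u: "Comp Q F F E 0 1 \<alpha> u = \<nu> \<oplus>\<^bsub>Hom Q F E 1\<^esub> ?DFE 0 v"
  proof -
    have c: "Comp Q F E E 0 1 ?Dh y \<in> carrier (Hom Q F E 1)"
      using Q.Comp_closed[OF F E E Dh ker_closed[OF y]] by simp
    have "?DFE 0 v = \<ominus>\<^bsub>Hom Q F E 1\<^esub> Comp Q F E E 0 1 ?Dh y"
      unfolding v_def
      using Q.twisted_Diff_minus[OF F E \<zeta>(1) \<eta>(1) ker_closed[OF hy]]
        twisted_Diff_homotopy_Comp[OF F E E \<zeta>(1) \<eta>(1) \<eta>(1) h(1), of y 0] ker_closed[OF y] Dy
      by simp
    moreover have "Comp Q F F E 0 1 \<alpha> u = Comp Q F F E 0 1 \<alpha> u\<^sub>0 \<ominus>\<^bsub>Hom Q F E 1\<^esub>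
        (Comp Q F E E 0 1 ?Dh y \<oplus>\<^bsub>Hom Q F E 1\<^esub> y)"
      unfolding u_def a_minus_def
      using Q.Comp_add_right[OF F F E \<alpha>(1) ker_closed[OF u\<^sub>0] F1.a_inv_closed[OF ker_closed[OF ay]]]
        Q.Comp_minus_right[OF F F E \<alpha>(1) ker_closed[OF ay]] \<alpha>a[OF y] by simp
    moreover have "Comp Q F F E 0 1 \<alpha> u\<^sub>0 = \<nu> \<oplus>\<^bsub>Hom Q F E 1\<^esub> y"
      unfolding y_def using ker_closed[OF \<alpha>u\<^sub>0] ker_closed[OF \<nu>] by algebra
    ultimately show ?thesis
      using c ker_closed[OF y] ker_closed[OF \<nu>] by simp algebra
  qed

  show ?thesis
  proof (intro bexI conjI)
    let ?\<zeta> = "\<zeta> \<oplus>\<^bsub>Hom Q F F 1\<^esub> u" and ?\<alpha> = "\<alpha> \<oplus>\<^bsub>Hom Q F E 0\<^esub> v"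
    note u' = ker_closed[OF u] and v' = ker_closed[OF v]
    show "?\<zeta> \<in> carrier (Hom Q F F 1)" "?\<alpha> \<in> carrier (Hom Q F E 0)"
      using \<zeta> \<alpha> u' v' by simp_all
    show "p F F 1 ?\<zeta> = \<zeta>'"
      using p_add[OF F F \<zeta>(1) u'] \<zeta> \<zeta>' u by (simp add: ker_def)
    show "p F E 0 ?\<alpha> = \<alpha>'"
      using p_add[OF F E \<alpha>(1) v'] \<alpha> \<alpha>' v by (simp add: ker_def)
    show "Q.curvature F ?\<zeta> = \<zero>\<^bsub>Hom Q F F 2\<^esub>"
      using Q.curvature_perturbation[OF F \<zeta>(1) u'] ker_Comp_ker[OF F F F u u] Du ker_closed[OF \<kappa>]
      by (simp add: \<kappa>_def[symmetric] F2.r_neg)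
    show "twisted_Diff Q F E ?\<zeta> \<eta> 0 ?\<alpha> = \<zero>\<^bsub>Hom Q F E 1\<^esub>"
      using Q.twisted_Diff_perturbation[OF F E \<zeta>(1) \<eta>(1) u' \<alpha>(1) v'] ker_Comp_ker[OF F F E v u]
        \<alpha>u ker_closed[OF \<nu>] ker_closed[OF ker_twisted_Diff[OF F E \<zeta>(1) \<eta>(1) v]]
      by (simp add: \<nu>_def[symmetric] a_minus_def FE1.r_neg)
  qed
qed

end

section \<open>Tensor products by generators and relations\<close>

definition tens ::
    "('k, 'x) ring_scheme \<Rightarrow> ('k, 'm) module \<Rightarrow> ('k, 'b) module \<Rightarrow> 'm \<Rightarrow> 'b \<Rightarrow>
     ('m \<times> 'b \<Rightarrow>\<^sub>0 int) set"
  where "tens K V R v r = tensor_class K V R (frag_of (v, r))"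

lemma free_minus_closed:
  "x \<in> carrier (free_Abelian_group S) \<Longrightarrow> y \<in> carrier (free_Abelian_group S) \<Longrightarrow>
    x - y \<in> carrier (free_Abelian_group S)"
  using keys_diff[of x y] by auto

lemma free_plus_closed:
  "x \<in> carrier (free_Abelian_group S) \<Longrightarrow> y \<in> carrier (free_Abelian_group S) \<Longrightarrow>
    x + y \<in> carrier (free_Abelian_group S)"
  using keys_add[of x y] by auto

locale tensor_product = V: module K V + R: module K R
  for K :: "('k, 'x) ring_scheme" and V :: "('k, 'm) module" and R :: "('k, 'b) module"
begin

abbreviation Free where "Free \<equiv> tensor_free V R"
abbreviation Rel where "Rel \<equiv> tensor_relations K V R"
abbreviation cls where "cls \<equiv> tensor_class K V R"
abbreviation T where "T \<equiv> base_change K V R"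
abbreviation tn (infix "\<otimes>\<^sub>t" 75) where "v \<otimes>\<^sub>t r \<equiv> tens K V R v r"

lemma relations_subgroup: "subgroup Rel Free"
  unfolding tensor_relations_def
  by (rule group.generate_is_subgroup)
    (auto intro!: free_minus_closed simp del: carrier_free_Abelian_group_iff)

lemma relations_normal: "normal Rel Free"
  by (rule comm_group.subgroup_imp_normal[OF abelian_free_Abelian_group relations_subgroup])

lemma comm_group_Mod: "comm_group (Free Mod Rel)"
  using comm_group.abelian_FactGroup[OF abelian_free_Abelian_group relations_subgroup] .

lemma T_simps:
  "carrier T = carrier (Free Mod Rel)"
  "x \<oplus>\<^bsub>T\<^esub> y = x \<otimes>\<^bsub>Free Mod Rel\<^esub> y"
  "\<zero>\<^bsub>T\<^esub> = \<one>\<^bsub>Free Mod Rel\<^esub>"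
  by (simp_all add: base_change_def Let_def)

lemma T_abelian_group: "abelian_group T"
proof -
  interpret M: comm_group "Free Mod Rel" by (rule comm_group_Mod)
  show ?thesis
    by (rule abelian_groupI)
      (auto simp: T_simps M.m_ac M.l_inv_ex simp del: mult_FactGroup one_FactGroup)
qed

sublocale T: abelian_group T by (rule T_abelian_group)

lemma T_carrier: "carrier T = cls ` carrier Free"
  by (auto simp: T_simps FactGroup_def RCOSETS_def tensor_class_def)

lemma cls_closed: "x \<in> carrier Free \<Longrightarrow> cls x \<in> carrier T"
  by (simp only: T_carrier) blast

lemma cls_add:
  assumes "x \<in> carrier Free" "y \<in> carrier Free"
  shows "cls (x + y) = cls x \<oplus>\<^bsub>T\<^esub> cls y"
  using normal.rcos_sum[OF relations_normal assms]
  by (simp add: T_simps tensor_class_def)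

lemma cls_hom: "cls \<in> hom Free (add_monoid T)"
  using cls_closed cls_add by (auto simp: hom_def)

lemma cls_self: "x \<in> carrier Free \<Longrightarrow> x \<in> cls x"
  unfolding tensor_class_def
  by (rule group.rcos_self[OF group_free_Abelian_group _ relations_subgroup])

lemma cls_memD:
  assumes "y \<in> cls x" "x \<in> carrier Free"
  shows "y \<in> carrier Free" "cls y = cls x"
proof -
  show "y \<in> carrier Free"
    using subgroup.elemrcos_carrier[OF relations_subgroup group_free_Abelian_group] assms
    unfolding tensor_class_def by blast
  show "cls y = cls x"
    using group.repr_independence[OF group_free_Abelian_group _ _ relations_subgroup] assms
    unfolding tensor_class_def by metis
qed

lemma T_memE:
  assumes "\<xi> \<in> carrier T"
  obtains x where "x \<in> carrier Free" "\<xi> = cls x"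
  using assms unfolding T_carrier by blast

lemma hom_minus:
  assumes "group_hom Free A h" "x \<in> carrier Free" "y \<in> carrier Free"
  shows "h (x - y) = h x \<otimes>\<^bsub>A\<^esub> inv\<^bsub>A\<^esub> h y"
proof -
  interpret group_hom Free A h by fact
  show ?thesis
    using hom_mult[of x "-y"] hom_inv[of y] assms(2,3) by simp
qed

lemma tens_closed [simp]: "v \<in> carrier V \<Longrightarrow> r \<in> carrier R \<Longrightarrow> v \<otimes>\<^sub>t r \<in> carrier T"
  unfolding tens_def by (rule cls_closed) simp

lemma cls_group_hom: "group_hom Free (add_monoid T) cls"
  by (simp add: group_hom_def group_hom_axioms_def cls_hom T.a_group)

lemma cls_Rel: 
  assumes "x \<in> Rel" shows "cls x = \<zero>\<^bsub>T\<^esub>"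
  using subgroup.rcos_const[OF relations_subgroup group_free_Abelian_group assms]
  by (simp add: T_simps tensor_class_def)

lemma
  assumes "v \<in> carrier V" "r \<in> carrier R"
  shows tens_add_left: "w \<in> carrier V \<Longrightarrow> (v \<oplus>\<^bsub>V\<^esub> w) \<otimes>\<^sub>t r = v \<otimes>\<^sub>t r \<oplus>\<^bsub>T\<^esub> w \<otimes>\<^sub>t r"
    and tens_add_right: "s \<in> carrier R \<Longrightarrow> v \<otimes>\<^sub>t (r \<oplus>\<^bsub>R\<^esub> s) = v \<otimes>\<^sub>t r \<oplus>\<^bsub>T\<^esub> v \<otimes>\<^sub>t s"
    and tens_smult: "c \<in> carrier K \<Longrightarrow> (c \<odot>\<^bsub>V\<^esub> v) \<otimes>\<^sub>t r = v \<otimes>\<^sub>t (c \<odot>\<^bsub>R\<^esub> r)"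
proof -
  have key: "cls x = cls y" if "x - y \<in> Rel" "x \<in> carrier Free" "y \<in> carrier Free" for x y
    using cls_add[of "x - y" y] cls_Rel[OF that(1)] that cls_closed[OF that(3)]
      subgroup.mem_carrier[OF relations_subgroup that(1)] by simp
  show "(v \<oplus>\<^bsub>V\<^esub> w) \<otimes>\<^sub>t r = v \<otimes>\<^sub>t r \<oplus>\<^bsub>T\<^esub> w \<otimes>\<^sub>t r" if "w \<in> carrier V"
  proof -
    have "frag_of (v \<oplus>\<^bsub>V\<^esub> w, r) - (frag_of (v, r) + frag_of (w, r)) \<in> Rel"
      unfolding tensor_relations_def diff_diff_eq[symmetric] using assms that
      by (intro generate.incl) blast
    then have "cls (frag_of (v \<oplus>\<^bsub>V\<^esub> w, r)) = cls (frag_of (v, r) + frag_of (w, r))"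
      using assms that by (intro key free_plus_closed) auto
    then show ?thesis using assms that by (simp add: tens_def cls_add)
  qed
  show "v \<otimes>\<^sub>t (r \<oplus>\<^bsub>R\<^esub> s) = v \<otimes>\<^sub>t r \<oplus>\<^bsub>T\<^esub> v \<otimes>\<^sub>t s" if "s \<in> carrier R"
  proof -
    have "frag_of (v, r \<oplus>\<^bsub>R\<^esub> s) - (frag_of (v, r) + frag_of (v, s)) \<in> Rel"
      unfolding tensor_relations_def diff_diff_eq[symmetric] using assms that
      by (intro generate.incl) blast
    then have "cls (frag_of (v, r \<oplus>\<^bsub>R\<^esub> s)) = cls (frag_of (v, r) + frag_of (v, s))"
      using assms that by (intro key free_plus_closed) auto
    then show ?thesis using assms that by (simp add: tens_def cls_add)
  qed
  show "(c \<odot>\<^bsub>V\<^esub> v) \<otimes>\<^sub>t r = v \<otimes>\<^sub>t (c \<odot>\<^bsub>R\<^esub> r)" if "c \<in> carrier K"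
  proof -
    have "frag_of (c \<odot>\<^bsub>V\<^esub> v, r) - frag_of (v, c \<odot>\<^bsub>R\<^esub> r) \<in> Rel"
      unfolding tensor_relations_def using assms that
      by (intro generate.incl) blast
    then show ?thesis
      unfolding tens_def using assms that by (intro key) auto
  qed
qed

text \<open>
  The case of zero is omitted because zero is a difference of a generator with itself.
\<close>

lemma Free_induct [consumes 1, case_names tens diff]:
  assumes "x \<in> carrier Free"
    and tens: "\<And>v r. v \<in> carrier V \<Longrightarrow> r \<in> carrier R \<Longrightarrow> Q (frag_of (v, r))"
    and diff: "\<And>x y. x \<in> carrier Free \<Longrightarrow> y \<in> carrier Free \<Longrightarrow> Q x \<Longrightarrow> Q y \<Longrightarrow> Q (x - y)"
  shows "Q x"
proof (rule free_Abelian_group_induct[where P = Q and S = "carrier V \<times> carrier R"])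
  have "frag_of (\<zero>\<^bsub>V\<^esub>, \<zero>\<^bsub>R\<^esub>) \<in> carrier Free" by simp
  then show "Q 0"
    using diff[of "frag_of (\<zero>\<^bsub>V\<^esub>, \<zero>\<^bsub>R\<^esub>)" "frag_of (\<zero>\<^bsub>V\<^esub>, \<zero>\<^bsub>R\<^esub>)"] tens by simp
qed (use assms in auto)

lemma cls_diff:
  assumes "x \<in> carrier Free" "y \<in> carrier Free"
  shows "cls (x - y) = cls x \<ominus>\<^bsub>T\<^esub> cls y"
  using hom_minus[OF cls_group_hom assms] by (simp add: a_inv_def a_minus_def)

lemma tens_minus:
  assumes "v \<in> carrier V" "r \<in> carrier R"
  shows "(\<ominus>\<^bsub>V\<^esub> v) \<otimes>\<^sub>t r = \<ominus>\<^bsub>T\<^esub> (v \<otimes>\<^sub>t r)"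
proof -
  have "(\<ominus>\<^bsub>V\<^esub> v \<oplus>\<^bsub>V\<^esub> v) \<otimes>\<^sub>t r = (\<ominus>\<^bsub>V\<^esub> v) \<otimes>\<^sub>t r \<oplus>\<^bsub>T\<^esub> v \<otimes>\<^sub>t r"
    "(\<zero>\<^bsub>V\<^esub> \<oplus>\<^bsub>V\<^esub> \<zero>\<^bsub>V\<^esub>) \<otimes>\<^sub>t r = \<zero>\<^bsub>V\<^esub> \<otimes>\<^sub>t r \<oplus>\<^bsub>T\<^esub> \<zero>\<^bsub>V\<^esub> \<otimes>\<^sub>t r"
    using assms by (simp_all only: tens_add_left V.a_inv_closed V.zero_closed)
  moreover from this(2) have "\<zero>\<^bsub>V\<^esub> \<otimes>\<^sub>t r = \<zero>\<^bsub>T\<^esub>"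
    using assms T.add.r_cancel_one'[of "\<zero>\<^bsub>V\<^esub> \<otimes>\<^sub>t r" "\<zero>\<^bsub>V\<^esub> \<otimes>\<^sub>t r"] by simp
  ultimately show ?thesis
    using assms T.minus_equality[of "(\<ominus>\<^bsub>V\<^esub> v) \<otimes>\<^sub>t r" "v \<otimes>\<^sub>t r"] by (simp add: V.l_neg)
qed

lemma tens_zero_left: "r \<in> carrier R \<Longrightarrow> \<zero>\<^bsub>V\<^esub> \<otimes>\<^sub>t r = \<zero>\<^bsub>T\<^esub>"
  using tens_add_left[of "\<zero>\<^bsub>V\<^esub>" r "\<zero>\<^bsub>V\<^esub>"]
    T.add.r_cancel_one'[of "\<zero>\<^bsub>V\<^esub> \<otimes>\<^sub>t r" "\<zero>\<^bsub>V\<^esub> \<otimes>\<^sub>t r"] by simp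

lemma tens_zero_right: "v \<in> carrier V \<Longrightarrow> v \<otimes>\<^sub>t \<zero>\<^bsub>R\<^esub> = \<zero>\<^bsub>T\<^esub>"
  using tens_add_right[of v "\<zero>\<^bsub>R\<^esub>" "\<zero>\<^bsub>R\<^esub>"]
    T.add.r_cancel_one'[of "v \<otimes>\<^sub>t \<zero>\<^bsub>R\<^esub>" "v \<otimes>\<^sub>t \<zero>\<^bsub>R\<^esub>"] by simp

text \<open>
  The negative of a pure tensor is pure, so sums of pure tensors exhaust the tensor product. All
  identities between additive maps on tensor products are proved by this rule.
\<close>

lemma tens_induct [consumes 1, case_names tens add]:
  assumes "\<xi> \<in> carrier T"
    and tens: "\<And>v r. v \<in> carrier V \<Longrightarrow> r \<in> carrier R \<Longrightarrow> Q (v \<otimes>\<^sub>t r)"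
    and add: "\<And>\<xi> \<upsilon>. \<xi> \<in> carrier T \<Longrightarrow> \<upsilon> \<in> carrier T \<Longrightarrow> Q \<xi> \<Longrightarrow> Q \<upsilon> \<Longrightarrow> Q (\<xi> \<oplus>\<^bsub>T\<^esub> \<upsilon>)"
  shows "Q \<xi>"
proof -
  obtain x where x: "x \<in> carrier Free" "\<xi> = cls x"
    using T_memE assms(1) by blast
  from x(1) have "Q (cls x) \<and> Q (\<ominus>\<^bsub>T\<^esub> cls x)"
  proof (induction rule: Free_induct)
    case (tens v r)
    then show ?case
      using assms(2)[of v r] assms(2)[of "\<ominus>\<^bsub>V\<^esub> v" r] tens_minus[of v r]
      by (simp add: tens_def)
  next
    case (diff x y)
    then have c: "cls x \<in> carrier T" "cls y \<in> carrier T"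
      using cls_closed by blast+
    have "\<ominus>\<^bsub>T\<^esub> cls (x - y) = \<ominus>\<^bsub>T\<^esub> cls x \<oplus>\<^bsub>T\<^esub> cls y"
      using c diff(1,2) by (simp add: cls_diff a_minus_def T.minus_add)
    then show ?case
      using c diff by (auto simp: cls_diff a_minus_def intro!: add)
  qed
  with x show ?thesis by simp
qed

text \<open>
  The universal property of the tensor product, stated for homomorphisms on the free group: a
  balanced biadditive map into any abelian group is constant on the classes. It is what makes the
  operations that are defined by uniting over all representatives well defined.
\<close>

lemma hom_respects_relations:
  assumes "comm_group A" and \<Phi>: "\<Phi> \<in> hom Free A"
    and add_left: "\<And>v w r. v \<in> carrier V \<Longrightarrow> w \<in> carrier V \<Longrightarrow> r \<in> carrier R \<Longrightarrow>
      \<Phi> (frag_of (v \<oplus>\<^bsub>V\<^esub> w, r)) = \<Phi> (frag_of (v, r)) \<otimes>\<^bsub>A\<^esub> \<Phi> (frag_of (w, r))"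
    and add_right: "\<And>v r s. v \<in> carrier V \<Longrightarrow> r \<in> carrier R \<Longrightarrow> s \<in> carrier R \<Longrightarrow>
      \<Phi> (frag_of (v, r \<oplus>\<^bsub>R\<^esub> s)) = \<Phi> (frag_of (v, r)) \<otimes>\<^bsub>A\<^esub> \<Phi> (frag_of (v, s))"
    and smult: "\<And>c v r. c \<in> carrier K \<Longrightarrow> v \<in> carrier V \<Longrightarrow> r \<in> carrier R \<Longrightarrow>
      \<Phi> (frag_of (c \<odot>\<^bsub>V\<^esub> v, r)) = \<Phi> (frag_of (v, c \<odot>\<^bsub>R\<^esub> r))"
    and x: "x \<in> carrier Free" and y: "y \<in> cls x"
  shows "\<Phi> y = \<Phi> x"
proof -
  interpret A: comm_group A by fact
  interpret \<Phi>: group_hom Free A \<Phi>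
    by (simp add: group_hom_def group_hom_axioms_def \<Phi> A.is_group)
  have "Rel \<subseteq> kernel Free A \<Phi>"
    unfolding tensor_relations_def
  proof (intro group.generate_subgroup_incl subsetI)
    show "subgroup (kernel Free A \<Phi>) Free" by (rule \<Phi>.subgroup_kernel)
    have m: "\<Phi> (x - y) = \<Phi> x \<otimes>\<^bsub>A\<^esub> inv\<^bsub>A\<^esub> \<Phi> y" if "x \<in> carrier Free" "y \<in> carrier Free" for x y
      using hom_minus[OF \<Phi>.group_hom_axioms that] .
    have k: "x - y \<in> kernel Free A \<Phi>" if "x \<in> carrier Free" "y \<in> carrier Free" "\<Phi> x = \<Phi> y" for x y
      using that free_minus_closed[OF that(1,2)] m[OF that(1,2)]
      by (simp add: kernel_def del: carrier_free_Abelian_group_iff)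
    fix z assume "z \<in> {frag_of (v \<oplus>\<^bsub>V\<^esub> w, r) - frag_of (v, r) - frag_of (w, r) | v w r.
        v \<in> carrier V \<and> w \<in> carrier V \<and> r \<in> carrier R} \<union>
     {frag_of (v, r \<oplus>\<^bsub>R\<^esub> s) - frag_of (v, r) - frag_of (v, s) | v r s.
        v \<in> carrier V \<and> r \<in> carrier R \<and> s \<in> carrier R} \<union>
     {frag_of (c \<odot>\<^bsub>V\<^esub> v, r) - frag_of (v, c \<odot>\<^bsub>R\<^esub> r) | c v r.
        c \<in> carrier K \<and> v \<in> carrier V \<and> r \<in> carrier R}"
    then consider
        v w r where "v \<in> carrier V" "w \<in> carrier V" "r \<in> carrier R"
          "z = frag_of (v \<oplus>\<^bsub>V\<^esub> w, r) - (frag_of (v, r) + frag_of (w, r))"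
      | v r s where "v \<in> carrier V" "r \<in> carrier R" "s \<in> carrier R"
          "z = frag_of (v, r \<oplus>\<^bsub>R\<^esub> s) - (frag_of (v, r) + frag_of (v, s))"
      | c v r where "c \<in> carrier K" "v \<in> carrier V" "r \<in> carrier R"
          "z = frag_of (c \<odot>\<^bsub>V\<^esub> v, r) - frag_of (v, c \<odot>\<^bsub>R\<^esub> r)"
      by (auto simp: diff_diff_eq)
    then show "z \<in> kernel Free A \<Phi>"
    proof cases
      case 1
      then show ?thesis
        using \<Phi>.hom_mult[of "frag_of (v, r)" "frag_of (w, r)"] add_left
        by (auto intro!: k free_plus_closed simp del: carrier_free_Abelian_group_iff)
    next
      case 2
      then show ?thesis
        using \<Phi>.hom_mult[of "frag_of (v, r)" "frag_of (v, s)"] add_right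
        by (auto intro!: k free_plus_closed simp del: carrier_free_Abelian_group_iff)
    next
      case 3
      then show ?thesis
        using smult by (auto intro!: k simp del: carrier_free_Abelian_group_iff)
    qed
  qed simp
  moreover obtain n where n: "n \<in> Rel" "y = n + x"
    using y unfolding tensor_class_def r_coset_def by auto
  ultimately have "n \<in> carrier Free" "\<Phi> n = \<one>\<^bsub>A\<^esub>"
    unfolding kernel_def by blast+
  then show ?thesis
    using \<Phi>.hom_mult[of n x] x n(2) by simp
qed

end

section \<open>Maps and pairings of tensor products\<close>

definition linear_map ::
    "('k, 'x) ring_scheme \<Rightarrow> ('k, 'm, 'y) module_scheme \<Rightarrow> ('k, 'n, 'z) module_scheme \<Rightarrow>
     ('m \<Rightarrow> 'n) \<Rightarrow> bool"
  where "linear_map K V W f \<longleftrightarrow> f \<in> carrier V \<rightarrow> carrier W \<and>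
    (\<forall>v\<in>carrier V. \<forall>w\<in>carrier V. f (v \<oplus>\<^bsub>V\<^esub> w) = f v \<oplus>\<^bsub>W\<^esub> f w) \<and>
    (\<forall>c\<in>carrier K. \<forall>v\<in>carrier V. f (c \<odot>\<^bsub>V\<^esub> v) = c \<odot>\<^bsub>W\<^esub> f v)"

lemma linear_mapD:
  assumes "linear_map K V W f"
  shows "v \<in> carrier V \<Longrightarrow> f v \<in> carrier W"
    "v \<in> carrier V \<Longrightarrow> w \<in> carrier V \<Longrightarrow> f (v \<oplus>\<^bsub>V\<^esub> w) = f v \<oplus>\<^bsub>W\<^esub> f w"
    "c \<in> carrier K \<Longrightarrow> v \<in> carrier V \<Longrightarrow> f (c \<odot>\<^bsub>V\<^esub> v) = c \<odot>\<^bsub>W\<^esub> f v"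
  using assms unfolding linear_map_def by auto

text \<open>
  The map \<open>f \<otimes> \<phi>\<close>. The differentials, the scalar multiplication and the reduction modulo an ideal
  are all of this form, with \<open>f\<close> or \<open>\<phi>\<close> the identity.
\<close>

definition tensor_map ::
    "('k, 'x) ring_scheme \<Rightarrow> ('k, 'n) module \<Rightarrow> ('k, 'c) module \<Rightarrow> ('m \<Rightarrow> 'n) \<Rightarrow> ('b \<Rightarrow> 'c) \<Rightarrow>
     ('m \<times> 'b \<Rightarrow>\<^sub>0 int) set \<Rightarrow> ('n \<times> 'c \<Rightarrow>\<^sub>0 int) set"
  where "tensor_map K W S f \<phi> \<xi> =
    (\<Union>x\<in>\<xi>. tensor_class K W S (frag_extend (\<lambda>(v, r). frag_of (f v, \<phi> r)) x))"

locale tensor_functoriality =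
  S: tensor_product K V R + D: tensor_product K W S for K V R W S +
  fixes f \<phi>
  assumes f: "linear_map K V W f" and \<phi>: "linear_map K R S \<phi>"
begin

lemma frag_closed:
  "x \<in> carrier S.Free \<Longrightarrow> frag_extend (\<lambda>(v, r). frag_of (f v, \<phi> r)) x \<in> carrier D.Free"
proof (induction rule: S.Free_induct)
  case (tens v r)
  then show ?case using f \<phi> by (auto dest: linear_mapD)
next
  case (diff x y)
  then show ?case by (simp only: frag_extend_diff free_minus_closed)
qed

lemma tensor_map_cls:
  assumes x: "x \<in> carrier S.Free"
  shows "tensor_map K W S f \<phi> (S.cls x) =
    D.cls (frag_extend (\<lambda>(v, r). frag_of (f v, \<phi> r)) x)"
proof -
  define \<Phi> where "\<Phi> x = D.cls (frag_extend (\<lambda>(v, r). frag_of (f v, \<phi> r)) x)" for x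
  have "\<Phi> y = \<Phi> x" if "y \<in> S.cls x" for y
  proof (rule S.hom_respects_relations[of "add_monoid D.T"])
    show "comm_group (add_monoid D.T)" by (rule D.T.a_comm_group)
    show "\<Phi> \<in> hom S.Free (add_monoid D.T)"
      unfolding \<Phi>_def using frag_closed
      by (intro homI)
        (simp_all add: frag_extend_add D.cls_add D.cls_closed del: carrier_free_Abelian_group_iff)
  qed (use x that f \<phi> in \<open>simp_all add: \<Phi>_def linear_mapD tens_def[symmetric] D.tens_add_left
        D.tens_add_right D.tens_smult del: carrier_free_Abelian_group_iff\<close>)
  then show ?thesis
    using S.cls_self[OF x] unfolding tensor_map_def \<Phi>_def by blast
qed

lemma tensor_map_tens:
  "v \<in> carrier V \<Longrightarrow> r \<in> carrier R \<Longrightarrow>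
    tensor_map K W S f \<phi> (tens K V R v r) = tens K W S (f v) (\<phi> r)"
  using tensor_map_cls[of "frag_of (v, r)"] by (simp add: tens_def)

lemma tensor_map_closed: "\<xi> \<in> carrier S.T \<Longrightarrow> tensor_map K W S f \<phi> \<xi> \<in> carrier D.T"
  by (metis S.T_memE tensor_map_cls D.cls_closed frag_closed)

lemma tensor_map_add:
  assumes "\<xi> \<in> carrier S.T" "\<upsilon> \<in> carrier S.T"
  shows "tensor_map K W S f \<phi> (\<xi> \<oplus>\<^bsub>S.T\<^esub> \<upsilon>) =
    tensor_map K W S f \<phi> \<xi> \<oplus>\<^bsub>D.T\<^esub> tensor_map K W S f \<phi> \<upsilon>"
proof -
  obtain x y where "x \<in> carrier S.Free" "\<xi> = S.cls x" "y \<in> carrier S.Free" "\<upsilon> = S.cls y"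
    using assms S.T_memE by metis
  then show ?thesis
    by (simp add: S.cls_add[symmetric] tensor_map_cls D.cls_add frag_closed frag_extend_add
        free_plus_closed del: carrier_free_Abelian_group_iff)
qed

end

text \<open>
  The extension of scalars of a bilinear map \<open>\<mu>\<close>, in the form in which composition is extended.
\<close>

definition tensor_bilinear ::
    "('k, 'x) ring_scheme \<Rightarrow> ('k, 'u) module \<Rightarrow> ('k, 'b) module \<Rightarrow> ('w \<Rightarrow> 'v \<Rightarrow> 'u) \<Rightarrow>
     ('w \<times> 'b \<Rightarrow>\<^sub>0 int) set \<Rightarrow> ('v \<times> 'b \<Rightarrow>\<^sub>0 int) set \<Rightarrow> ('u \<times> 'b \<Rightarrow>\<^sub>0 int) set"
  where "tensor_bilinear K U R \<mu> \<upsilon> \<xi> = (\<Union>y\<in>\<upsilon>. \<Union>x\<in>\<xi>. tensor_class K U R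
    (frag_extend (\<lambda>(b, s). frag_extend (\<lambda>(a, r). frag_of (\<mu> b a, s \<otimes>\<^bsub>R\<^esub> r)) x) y))"

lemma (in algebra) linear_map_mult:
  assumes r: "r \<in> carrier M" shows "linear_map R M M (\<lambda>s. r \<otimes>\<^bsub>M\<^esub> s)"
  unfolding linear_map_def
proof (intro conjI ballI)
  fix c s assume "c \<in> carrier R" "s \<in> carrier M"
  then show "r \<otimes>\<^bsub>M\<^esub> (c \<odot>\<^bsub>M\<^esub> s) = c \<odot>\<^bsub>M\<^esub> (r \<otimes>\<^bsub>M\<^esub> s)"
    using r m_comm[of r "c \<odot>\<^bsub>M\<^esub> s"] m_comm[of r s] smult_assoc2[of c s r] by simp
qed (use r in \<open>auto simp: r_distr\<close>)

locale tensor_pairing =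
  R: algebra K R + W: tensor_product K W R + V: tensor_product K V R + U: tensor_product K U R
  for K :: "('k, 'x) ring_scheme" and W :: "('k, 'w) module" and V :: "('k, 'v) module"
    and U :: "('k, 'u) module" and R :: "('k, 'b) module" +
  fixes \<mu>
  assumes linear_left: "v \<in> carrier V \<Longrightarrow> linear_map K W U (\<lambda>w. \<mu> w v)"
    and linear_right: "w \<in> carrier W \<Longrightarrow> linear_map K V U (\<mu> w)"
begin

abbreviation ins where
  "ins w s x \<equiv> frag_extend (\<lambda>(v, r). frag_of (\<mu> w v, s \<otimes>\<^bsub>R\<^esub> r)) x"

abbreviation pair where
  "pair y x \<equiv> frag_extend (\<lambda>(w, s). ins w s x) y"

lemma functoriality:
  "w \<in> carrier W \<Longrightarrow> s \<in> carrier R \<Longrightarrow> tensor_functoriality K V R U R (\<mu> w) (\<lambda>r. s \<otimes>\<^bsub>R\<^esub> r)"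
  using linear_right R.linear_map_mult
  by (intro tensor_functoriality.intro V.tensor_product_axioms U.tensor_product_axioms
      tensor_functoriality_axioms.intro) auto

lemma ins_closed:
  "w \<in> carrier W \<Longrightarrow> s \<in> carrier R \<Longrightarrow> x \<in> carrier V.Free \<Longrightarrow> ins w s x \<in> carrier U.Free"
  by (rule tensor_functoriality.frag_closed[OF functoriality])

lemma pair_closed:
  assumes "x \<in> carrier V.Free"
  shows "y \<in> carrier W.Free \<Longrightarrow> pair y x \<in> carrier U.Free"
proof (induction rule: W.Free_induct)
  case (tens v r)
  then show ?case using ins_closed assms by simp
next
  case (diff x y)
  then show ?case by (simp only: frag_extend_diff free_minus_closed)
qed

lemma pair_add_right: "pair y (x + x') = pair y x + pair y x'"
  by (induction y rule: frag_induction[OF subset_UNIV])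
    (auto simp: frag_extend_diff frag_extend_add)

lemma cls_ins:
  assumes "w \<in> carrier W" "s \<in> carrier R" "x \<in> carrier V.Free"
  shows "U.cls (ins w s x) = tensor_map K U R (\<mu> w) (\<lambda>r. s \<otimes>\<^bsub>R\<^esub> r) (V.cls x)"
  by (simp add: tensor_functoriality.tensor_map_cls[OF functoriality[OF assms(1,2)] assms(3)])

lemma cls_pair_right:
  assumes x: "x \<in> carrier V.Free" "x' \<in> V.cls x"
  shows "y \<in> carrier W.Free \<Longrightarrow> U.cls (pair y x') = U.cls (pair y x)"
proof (induction rule: W.Free_induct)
  case (tens w s)
  then show ?case
    using V.cls_memD[OF x(2,1)] x(1) by (simp add: cls_ins del: carrier_free_Abelian_group_iff)
next
  case (diff y y')
  then show ?case
    using V.cls_memD[OF x(2,1)] x(1) pair_closed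
    by (simp add: frag_extend_diff U.cls_diff del: carrier_free_Abelian_group_iff)
qed

text \<open>
  In the second argument, \<open>pair\<close> is built from maps \<open>\<mu> w \<otimes> s\<close>, which respect the relations. For the
  first argument the second one is fixed; the value at \<open>(w, s)\<close> is then \<open>\<mu> w \<otimes> s\<close> evaluated at
  a fixed tensor, and this is balanced in \<open>(w, s)\<close> because it is so on pure tensors.
\<close>

lemma cls_pair_left:
  assumes x: "x \<in> carrier V.Free" and y: "y \<in> carrier W.Free" "y' \<in> W.cls y"
  shows "U.cls (pair y' x) = U.cls (pair y x)"
proof -
  let ?L = "\<lambda>w s. tensor_map K U R (\<mu> w) (\<lambda>r. s \<otimes>\<^bsub>R\<^esub> r)"
  note [simp] = tensor_functoriality.tensor_map_tens[OF functoriality]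
    tensor_functoriality.tensor_map_add[OF functoriality]
    tensor_functoriality.tensor_map_closed[OF functoriality]
  note D = linear_mapD[OF linear_left] linear_mapD[OF linear_right]
  have L1: "?L (w \<oplus>\<^bsub>W\<^esub> w') s \<xi> = ?L w s \<xi> \<oplus>\<^bsub>U.T\<^esub> ?L w' s \<xi>"
    if "\<xi> \<in> carrier V.T" "w \<in> carrier W" "w' \<in> carrier W" "s \<in> carrier R" for w w' s \<xi>
    using that(1) by (induction rule: V.tens_induct)
      (use that(2-) in \<open>simp_all add: D U.tens_add_left U.T.add.m_ac\<close>)
  have L2: "?L w (s \<oplus>\<^bsub>R\<^esub> s') \<xi> = ?L w s \<xi> \<oplus>\<^bsub>U.T\<^esub> ?L w s' \<xi>"
    if "\<xi> \<in> carrier V.T" "w \<in> carrier W" "s \<in> carrier R" "s' \<in> carrier R" for w s s' \<xi>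
    using that(1) by (induction rule: V.tens_induct)
      (use that(2-) in \<open>simp_all add: D U.tens_add_right U.T.add.m_ac R.l_distr\<close>)
  have L3: "?L (c \<odot>\<^bsub>W\<^esub> w) s \<xi> = ?L w (c \<odot>\<^bsub>R\<^esub> s) \<xi>"
    if "\<xi> \<in> carrier V.T" "w \<in> carrier W" "s \<in> carrier R" "c \<in> carrier K" for w s c \<xi>
    using that(1) by (induction rule: V.tens_induct)
      (use that(2-) in \<open>simp_all add: D U.tens_smult R.smult_assoc2\<close>)
  show ?thesis
  proof (rule W.hom_respects_relations[of "add_monoid U.T" "\<lambda>y. U.cls (pair y x)"])
    show "comm_group (add_monoid U.T)" by (rule U.T.a_comm_group)
    show "(\<lambda>y. U.cls (pair y x)) \<in> hom W.Free (add_monoid U.T)"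
      using pair_closed[OF x]
      by (intro homI)
        (simp_all add: frag_extend_add U.cls_add U.cls_closed del: carrier_free_Abelian_group_iff)
  qed (use x y V.cls_closed[OF x] in \<open>simp_all add: cls_ins L1 L2 L3 del: carrier_free_Abelian_group_iff\<close>)
qed

lemma pairing_cls:
  assumes x: "x \<in> carrier V.Free" and y: "y \<in> carrier W.Free"
  shows "tensor_bilinear K U R \<mu> (W.cls y) (V.cls x) = U.cls (pair y x)"
proof -
  have eq: "U.cls (pair y' x') = U.cls (pair y x)" if "x' \<in> V.cls x" "y' \<in> W.cls y" for x' y'
    using cls_pair_left[OF x y that(2)] cls_pair_right[OF x that(1) W.cls_memD(1)[OF that(2) y]]
    by simp
  have "tensor_bilinear K U R \<mu> (W.cls y) (V.cls x) =
      (\<Union>y'\<in>W.cls y. \<Union>x'\<in>V.cls x. U.cls (pair y x))"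
    unfolding tensor_bilinear_def by (intro SUP_cong refl eq)
  then show ?thesis
    using V.cls_self[OF x] W.cls_self[OF y] by blast
qed

lemma pairing_tens:
  "w \<in> carrier W \<Longrightarrow> s \<in> carrier R \<Longrightarrow> v \<in> carrier V \<Longrightarrow> r \<in> carrier R \<Longrightarrow>
    tensor_bilinear K U R \<mu> (tens K W R w s) (tens K V R v r) = tens K U R (\<mu> w v) (s \<otimes>\<^bsub>R\<^esub> r)"
  using pairing_cls[of "frag_of (v, r)" "frag_of (w, s)"] unfolding tens_def by simp

lemma
  assumes "\<upsilon> \<in> carrier W.T" "\<xi> \<in> carrier V.T"
  shows pairing_closed: "tensor_bilinear K U R \<mu> \<upsilon> \<xi> \<in> carrier U.T"
    and pairing_add_left: "\<upsilon>' \<in> carrier W.T \<Longrightarrow> tensor_bilinear K U R \<mu> (\<upsilon> \<oplus>\<^bsub>W.T\<^esub> \<upsilon>') \<xi> =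
      tensor_bilinear K U R \<mu> \<upsilon> \<xi> \<oplus>\<^bsub>U.T\<^esub> tensor_bilinear K U R \<mu> \<upsilon>' \<xi>"
    and pairing_add_right: "\<xi>' \<in> carrier V.T \<Longrightarrow> tensor_bilinear K U R \<mu> \<upsilon> (\<xi> \<oplus>\<^bsub>V.T\<^esub> \<xi>') =
      tensor_bilinear K U R \<mu> \<upsilon> \<xi> \<oplus>\<^bsub>U.T\<^esub> tensor_bilinear K U R \<mu> \<upsilon> \<xi>'"
proof -
  obtain x where x: "x \<in> carrier V.Free" "\<xi> = V.cls x"
    using assms(2) by (rule V.T_memE)
  obtain y where y: "y \<in> carrier W.Free" "\<upsilon> = W.cls y"
    using assms(1) by (rule W.T_memE)
  note xy = x y
  show "tensor_bilinear K U R \<mu> \<upsilon> \<xi> \<in> carrier U.T"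
    using xy by (simp only: pairing_cls U.cls_closed pair_closed)
  show "tensor_bilinear K U R \<mu> (\<upsilon> \<oplus>\<^bsub>W.T\<^esub> \<upsilon>') \<xi> =
      tensor_bilinear K U R \<mu> \<upsilon> \<xi> \<oplus>\<^bsub>U.T\<^esub> tensor_bilinear K U R \<mu> \<upsilon>' \<xi>" if \<upsilon>': "\<upsilon>' \<in> carrier W.T"
  proof -
    obtain y' where "y' \<in> carrier W.Free" "\<upsilon>' = W.cls y'"
      using \<upsilon>' by (rule W.T_memE)
    with xy show ?thesis
      by (simp only: W.cls_add[symmetric] U.cls_add[symmetric] pairing_cls pair_closed
          frag_extend_add free_plus_closed)
  qed
  show "tensor_bilinear K U R \<mu> \<upsilon> (\<xi> \<oplus>\<^bsub>V.T\<^esub> \<xi>') =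
      tensor_bilinear K U R \<mu> \<upsilon> \<xi> \<oplus>\<^bsub>U.T\<^esub> tensor_bilinear K U R \<mu> \<upsilon> \<xi>'" if \<xi>': "\<xi>' \<in> carrier V.T"
  proof -
    obtain x' where "x' \<in> carrier V.Free" "\<xi>' = V.cls x'"
      using \<xi>' by (rule V.T_memE)
    with xy show ?thesis
      by (simp only: V.cls_add[symmetric] U.cls_add[symmetric] pairing_cls pair_closed
          pair_add_right free_plus_closed)
  qed
qed

end

section \<open>Extension of scalars of a dg-category\<close>

locale dg_scalar_extension = P: dg_category K P + R: algebra K R
  for K :: "('k, 'x) ring_scheme" and P :: "('o, 'k, 'm) dgcat" and R :: "('k, 'b) module"
begin

abbreviation PR where "PR \<equiv> dg_base_change K P R"
abbreviation tn where "tn E F i \<equiv> tens K (Hom P E F i) R"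

lemma Hom_eq: "Hom PR E F i = base_change K (Hom P E F i) R"
  by (simp add: dg_base_change_def)

lemma Ob_eq: "Ob PR = Ob P"
  by (simp add: dg_base_change_def)

lemma Diff_eq: "Diff PR E F i = tensor_map K (Hom P E F (i + 1)) R (Diff P E F i) (\<lambda>r. r)"
  by (rule ext) (simp add: dg_base_change_def tensor_map_def)

lemma Comp_eq: "Comp PR E F G j i = tensor_bilinear K (Hom P E G (j + i)) R (Comp P E F G j i)"
  by (intro ext) (simp add: dg_base_change_def tensor_bilinear_def)

lemma Ident_eq: "Ident PR E = tn E E 0 (Ident P E) \<one>\<^bsub>R\<^esub>"
  by (simp add: dg_base_change_def tens_def)

lemma smult_eq:
  "r \<odot>\<^bsub>Hom PR E F i\<^esub> \<xi> = tensor_map K (Hom P E F i) R (\<lambda>a. a) (\<lambda>s. r \<otimes>\<^bsub>R\<^esub> s) \<xi>"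
  by (simp add: Hom_eq base_change_def Let_def tensor_map_def)

context
  fixes E F assumes EF: "E \<in> Ob P" "F \<in> Ob P"
begin

lemma tensor_product_Hom: "tensor_product K (Hom P E F i) R"
  by (intro tensor_product.intro P.Hom_module EF R.module)

lemma Diff_functoriality:
  "tensor_functoriality K (Hom P E F i) R (Hom P E F (i + 1)) R (Diff P E F i) (\<lambda>r. r)"
  using EF
  by (intro tensor_functoriality.intro tensor_functoriality_axioms.intro tensor_product_Hom)
    (auto simp: linear_map_def P.Diff_closed P.Diff_add P.Diff_smult)

lemma smult_functoriality:
  "r \<in> carrier R \<Longrightarrow>
    tensor_functoriality K (Hom P E F i) R (Hom P E F i) R (\<lambda>a. a) (\<lambda>s. r \<otimes>\<^bsub>R\<^esub> s)"
  by (intro tensor_functoriality.intro tensor_functoriality_axioms.intro tensor_product_Hom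
      R.linear_map_mult) (auto simp: linear_map_def)

lemma Hom_abelian_group: "abelian_group (Hom PR E F i)"
  unfolding Hom_eq by (rule tensor_product.T_abelian_group[OF tensor_product_Hom])

lemmas tn_closed = tensor_product.tens_closed[OF tensor_product_Hom, folded Hom_eq]
lemmas tn_add_left = tensor_product.tens_add_left[OF tensor_product_Hom, folded Hom_eq]
lemmas tn_add_right = tensor_product.tens_add_right[OF tensor_product_Hom, folded Hom_eq]
lemmas tn_minus = tensor_product.tens_minus[OF tensor_product_Hom, folded Hom_eq]
lemmas tn_zero_left = tensor_product.tens_zero_left[OF tensor_product_Hom, folded Hom_eq]
lemmas tn_zero_right = tensor_product.tens_zero_right[OF tensor_product_Hom, folded Hom_eq]
lemmas Hom_induct_local [consumes 1, case_names tens add] =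
  tensor_product.tens_induct[OF tensor_product_Hom, folded Hom_eq]

lemmas PR_Diff_closed = tensor_functoriality.tensor_map_closed[OF Diff_functoriality,
    folded Hom_eq Diff_eq]
lemmas PR_Diff_add = tensor_functoriality.tensor_map_add[OF Diff_functoriality,
    folded Hom_eq Diff_eq]
lemmas PR_Diff_tens = tensor_functoriality.tensor_map_tens[OF Diff_functoriality,
    folded Hom_eq Diff_eq]
lemmas PR_smult_closed = tensor_functoriality.tensor_map_closed[OF smult_functoriality,
    folded Hom_eq smult_eq]
lemmas PR_smult_add = tensor_functoriality.tensor_map_add[OF smult_functoriality,
    folded Hom_eq smult_eq]
lemmas PR_smult_tens = tensor_functoriality.tensor_map_tens[OF smult_functoriality,
    folded Hom_eq smult_eq]

lemma PR_Hom_module: "module R (Hom PR E F i)"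
proof -
  interpret H: abelian_group "Hom PR E F i" by (rule Hom_abelian_group)
  note [simp] = PR_smult_closed PR_smult_add PR_smult_tens tn_closed tn_add_right
  show ?thesis
  proof (rule moduleI)
    fix a b x assume a: "a \<in> carrier R" "b \<in> carrier R" and x: "x \<in> carrier (Hom PR E F i)"
    show "(a \<oplus>\<^bsub>R\<^esub> b) \<odot>\<^bsub>Hom PR E F i\<^esub> x =
        a \<odot>\<^bsub>Hom PR E F i\<^esub> x \<oplus>\<^bsub>Hom PR E F i\<^esub> b \<odot>\<^bsub>Hom PR E F i\<^esub> x"
      using x by (induction rule: Hom_induct_local) (use a in \<open>simp_all add: H.add.m_ac R.l_distr\<close>)
    show "(a \<otimes>\<^bsub>R\<^esub> b) \<odot>\<^bsub>Hom PR E F i\<^esub> x =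
        a \<odot>\<^bsub>Hom PR E F i\<^esub> (b \<odot>\<^bsub>Hom PR E F i\<^esub> x)"
      using x by (induction rule: Hom_induct_local) (use a in \<open>simp_all add: R.m_assoc\<close>)
  next
    fix x assume x: "x \<in> carrier (Hom PR E F i)"
    show "\<one>\<^bsub>R\<^esub> \<odot>\<^bsub>Hom PR E F i\<^esub> x = x"
      using x by (induction rule: Hom_induct_local) simp_all
  qed (simp_all add: R.M_cring Hom_abelian_group)
qed

lemma signed_tens:
  assumes "a \<in> carrier (Hom P E F i)" "r \<in> carrier R"
  shows "signed (Hom PR E F i) j (tn E F i a r) = tn E F i (signed (Hom P E F i) j a) r"
  using assms by (simp add: signed_def tn_minus)

end

context
  fixes E F G assumes EFG: "E \<in> Ob P" "F \<in> Ob P" "G \<in> Ob P"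
begin

lemma Comp_pairing:
  "tensor_pairing K (Hom P F G j) (Hom P E F i) (Hom P E G (j + i)) R (Comp P E F G j i)"
  using EFG
  by (intro tensor_pairing.intro tensor_pairing_axioms.intro tensor_product_Hom R.algebra_axioms)
    (auto simp: linear_map_def P.Comp_closed P.Comp_add_left P.Comp_add_right P.Comp_smult_left
      P.Comp_smult_right)

lemmas PR_Comp_closed = tensor_pairing.pairing_closed[OF Comp_pairing, folded Hom_eq Comp_eq]
lemmas PR_Comp_tens = tensor_pairing.pairing_tens[OF Comp_pairing, folded Hom_eq Comp_eq]
lemmas PR_Comp_add_left =
  tensor_pairing.pairing_add_left[OF Comp_pairing, folded Hom_eq Comp_eq]
lemmas PR_Comp_add_right =
  tensor_pairing.pairing_add_right[OF Comp_pairing, folded Hom_eq Comp_eq]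

end

lemmas Hom_induct [consumes 3, case_names tens add] = Hom_induct_local

text \<open>
  All structure maps are additive and have the expected values on pure tensors, so every axiom
  follows by induction over tensors from the corresponding laws of \<open>P\<close> and \<open>R\<close>.
\<close>

theorem dg_category_base_change: "dg_category R PR"
proof -
  note [simp] = Ob_eq PR_Diff_closed PR_Diff_add PR_Diff_tens PR_smult_closed PR_smult_add
    PR_smult_tens PR_Comp_closed PR_Comp_tens PR_Comp_add_left PR_Comp_add_right tn_closed
    P.Diff_closed P.Comp_closed P.Ident_closed signed_closed signed_add signed_tens
    P.Hom_abelian_group Ident_eq
  show ?thesis
  proof (intro dg_category.intro dg_category_axioms.intro R.M_cring, unfold Ob_eq)
    fix E F i assume EF: "E \<in> Ob P" "F \<in> Ob P"
    show "module R (Hom PR E F i)" using PR_Hom_module EF .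
    interpret H1: abelian_group "Hom PR E F (i + 1)" using EF by (rule Hom_abelian_group)
    fix a assume a: "a \<in> carrier (Hom PR E F i)"
    show "Diff PR E F i (r \<odot>\<^bsub>Hom PR E F i\<^esub> a) = r \<odot>\<^bsub>Hom PR E F (i + 1)\<^esub> Diff PR E F i a"
      if "r \<in> carrier R" for r
      using EF a by (induction rule: Hom_induct) (use EF that in \<open>simp_all\<close>)
    show "Diff PR E F (i + 1) (Diff PR E F i a) = \<zero>\<^bsub>Hom PR E F (i + 2)\<^esub>"
    proof -
      interpret H2: abelian_group "Hom PR E F (i + 2)" using EF by (rule Hom_abelian_group)
      have [simp]: "i + 1 + 1 = i + 2" by simp
      show ?thesis
        using EF a by (induction rule: Hom_induct)
          (use EF in \<open>simp_all add: P.Diff_Diff tn_zero_left\<close>)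
    qed
    show "Comp PR E F F 0 i (Ident PR F) a = a"
      using EF a by (induction rule: Hom_induct)
        (use EF PR_Comp_tens[of E F F _ 0] PR_Comp_add_right[of E F F _ 0] in
          \<open>simp_all add: P.Comp_Ident_left\<close>)
    show "Comp PR E E F i 0 a (Ident PR E) = a"
      using EF a by (induction rule: Hom_induct)
        (use EF PR_Comp_tens[of E E F _ i _ _ 0] PR_Comp_add_left[of E E F _ i _ 0] in
          \<open>simp_all add: P.Comp_Ident_right\<close>)
  next
    fix E assume E: "E \<in> Ob P"
    show "Ident PR E \<in> carrier (Hom PR E E 0)" using E by simp
    show "Diff PR E E 0 (Ident PR E) = \<zero>\<^bsub>Hom PR E E 1\<^esub>"
      using E PR_Diff_tens[OF E E, of _ 0] by (simp add: P.Diff_Ident tn_zero_left)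
  next
    fix E F G j i b a
    assume EFG: "E \<in> Ob P" "F \<in> Ob P" "G \<in> Ob P"
      and b: "b \<in> carrier (Hom PR F G j)" and a: "a \<in> carrier (Hom PR E F i)"
    interpret H: abelian_group "Hom PR E G (j + i)" using EFG(1,3) by (rule Hom_abelian_group)
    show "Comp PR E F G j i (r \<odot>\<^bsub>Hom PR F G j\<^esub> b) a =
        r \<odot>\<^bsub>Hom PR E G (j + i)\<^esub> Comp PR E F G j i b a" if "r \<in> carrier R" for r
      using EFG(2,3) b
    proof (induction rule: Hom_induct)
      case (tens v s)
      show ?case
        using EFG(1,2) a by (induction rule: Hom_induct)
          (use EFG that tens in \<open>simp_all add: R.m_assoc\<close>)
    qed (use EFG that a in simp_all)
    show "Comp PR E F G j i b (r \<odot>\<^bsub>Hom PR E F i\<^esub> a) =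
        r \<odot>\<^bsub>Hom PR E G (j + i)\<^esub> Comp PR E F G j i b a" if "r \<in> carrier R" for r
      using EFG(2,3) b
    proof (induction rule: Hom_induct)
      case (tens v s)
      show ?case
        using EFG(1,2) a by (induction rule: Hom_induct)
          (use EFG that tens in \<open>simp_all add: R.m_lcomm\<close>)
    qed (use EFG that a in simp_all)
    interpret H1: abelian_group "Hom PR E G (j + i + 1)"
      using EFG(1,3) by (rule Hom_abelian_group)
    have deg [simp]: "j + 1 + i = j + i + 1" "j + (i + 1) = j + i + 1" by simp_all
    note CP = P.Comp_closed[OF EFG, where j = "j + 1" and i = i, unfolded deg]
      P.Comp_closed[OF EFG, where j = j and i = "i + 1", unfolded deg]
    note CR = PR_Comp_closed[OF EFG, where j = "j + 1" and i = i, unfolded deg]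
      PR_Comp_closed[OF EFG, where j = j and i = "i + 1", unfolded deg]
    note AR = PR_Comp_add_left[OF EFG, where j = "j + 1" and i = i, unfolded deg]
      PR_Comp_add_left[OF EFG, where j = j and i = "i + 1", unfolded deg]
      PR_Comp_add_right[OF EFG, where j = "j + 1" and i = i, unfolded deg]
      PR_Comp_add_right[OF EFG, where j = j and i = "i + 1", unfolded deg]
    note TR = PR_Comp_tens[OF EFG, where j = "j + 1" and i = i, unfolded deg]
      PR_Comp_tens[OF EFG, where j = j and i = "i + 1", unfolded deg]
    show "Diff PR E G (j + i) (Comp PR E F G j i b a) =
        Comp PR E F G (j + 1) i (Diff PR F G j b) a
          \<oplus>\<^bsub>Hom PR E G (j + i + 1)\<^esub>
        signed (Hom PR E G (j + i + 1)) j (Comp PR E F G j (i + 1) b (Diff PR E F i a))"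
      using EFG(2,3) b
    proof (induction rule: Hom_induct)
      case v: (tens v s)
      show ?case
        using EFG(1,2) a
      proof (induction rule: Hom_induct)
        case w: (tens w r)
        from v w EFG show ?case
          by (simp add: TR CP P.Diff_Comp tn_add_left)
      next
        case (add x y)
        with v EFG show ?case
          by (simp add: AR CR H1.abelian_group_axioms H1.add.m_ac)
      qed
    next
      case (add x y)
      with a EFG show ?case
        by (simp add: AR CR H1.abelian_group_axioms H1.add.m_ac)
    qed
  next
    fix E F G H l j i c b a
    assume O: "E \<in> Ob P" "F \<in> Ob P" "G \<in> Ob P" "H \<in> Ob P"
      and c: "c \<in> carrier (Hom PR G H l)"
      and b: "b \<in> carrier (Hom PR F G j)" and a: "a \<in> carrier (Hom PR E F i)"
    have deg [simp]: "l + j + i = l + (j + i)" by simp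
    note C1 = PR_Comp_closed[OF O(2-4), where j = l and i = j]
      PR_Comp_closed[OF O(1-3), where j = j and i = i]
    note A1 = PR_Comp_add_left[OF O(1,2,4), where j = "l + j" and i = i, unfolded deg]
      PR_Comp_add_right[OF O(1,2,4), where j = "l + j" and i = i, unfolded deg]
    note T1 = PR_Comp_tens[OF O(1,2,4), where j = "l + j" and i = i, unfolded deg]
    show "Comp PR E F H (l + j) i (Comp PR F G H l j c b) a =
        Comp PR E G H l (j + i) c (Comp PR E F G j i b a)"
      using O(3,4) c
    proof (induction rule: Hom_induct)
      case c: (tens v s)
      show ?case
        using O(2,3) b
      proof (induction rule: Hom_induct)
        case b: (tens w r)
        show ?case
          using O(1,2) a
        proof (induction rule: Hom_induct)
          case a: (tens u q)
          with b c O show ?case by (simp add: T1 P.Comp_assoc R.m_assoc)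
        qed (use O b c a in \<open>simp_all add: A1\<close>)
      qed (use O c a in \<open>simp_all add: A1\<close>)
    qed (use O a b in \<open>simp_all add: A1\<close>)
  qed (simp_all)
qed
end

section \<open>Quotient algebras\<close>

locale algebra_ideal = A: algebra K B + I: ideal I B
  for K :: "('k, 'x) ring_scheme" and B :: "('k, 'b) module" and I :: "'b set"
begin

abbreviation BI where "BI \<equiv> quot_algebra B I"
abbreviation \<pi> where "\<pi> b \<equiv> I +>\<^bsub>B\<^esub> b"

lemma BI_simps:
  "carrier BI = carrier (B Quot I)" "x \<otimes>\<^bsub>BI\<^esub> y = x \<otimes>\<^bsub>B Quot I\<^esub> y"
  "x \<oplus>\<^bsub>BI\<^esub> y = x \<oplus>\<^bsub>B Quot I\<^esub> y" "\<one>\<^bsub>BI\<^esub> = \<one>\<^bsub>B Quot I\<^esub>" "\<zero>\<^bsub>BI\<^esub> = \<zero>\<^bsub>B Quot I\<^esub>"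
  "c \<odot>\<^bsub>BI\<^esub> \<xi> = (\<Union>x\<in>\<xi>. \<pi> (c \<odot>\<^bsub>B\<^esub> x))"
  by (simp_all add: quot_algebra_def ring.defs module.defs)

lemma BI_carrier: "carrier BI = \<pi> ` carrier B"
  by (auto simp: BI_simps FactRing_simps)

text \<open>
  An ideal is stable under scalars since \<open>c x = (c 1) x\<close>; this makes the quotient an algebra.
\<close>

lemma ideal_smult: "c \<in> carrier K \<Longrightarrow> x \<in> I \<Longrightarrow> c \<odot>\<^bsub>B\<^esub> x \<in> I"
  using A.smult_assoc2[of c "\<one>\<^bsub>B\<^esub>" x] I.I_l_closed[of x "c \<odot>\<^bsub>B\<^esub> \<one>\<^bsub>B\<^esub>"] I.Icarr[of x] by simp

lemma \<pi>_eq_iff: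
  assumes "x \<in> carrier B" "y \<in> carrier B"
  shows "\<pi> x = \<pi> y \<longleftrightarrow> x \<ominus>\<^bsub>B\<^esub> y \<in> I"
proof -
  have "x \<ominus>\<^bsub>B\<^esub> y \<in> I \<longleftrightarrow> x \<in> \<pi> y"
    using I.a_rcos_module_minus[OF A.ring_axioms assms(2,1)] by simp
  also have "\<dots> \<longleftrightarrow> \<pi> x = \<pi> y"
    using I.a_repr_independence'[of x y] I.a_rcos_self[OF assms(1)] assms by metis
  finally show ?thesis by simp
qed

lemma \<pi>_smult:
  assumes c: "c \<in> carrier K" and x: "x \<in> carrier B"
  shows "c \<odot>\<^bsub>BI\<^esub> \<pi> x = \<pi> (c \<odot>\<^bsub>B\<^esub> x)"
proof -
  have eq: "\<pi> (c \<odot>\<^bsub>B\<^esub> y) = \<pi> (c \<odot>\<^bsub>B\<^esub> x)" if y: "y \<in> \<pi> x" for y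
  proof -
    have y': "y \<in> carrier B" by (rule I.a_elemrcos_carrier[OF x y])
    moreover have "y \<ominus>\<^bsub>B\<^esub> x \<in> I"
      using I.a_repr_independence'[OF y x] \<pi>_eq_iff[OF y' x] by simp
    ultimately show ?thesis
      using c x ideal_smult[OF c, of "y \<ominus>\<^bsub>B\<^esub> x"]
      by (simp add: \<pi>_eq_iff a_minus_def A.smult_r_distr A.smult_r_minus)
  qed
  have "c \<odot>\<^bsub>BI\<^esub> \<pi> x = (\<Union>y\<in>\<pi> x. \<pi> (c \<odot>\<^bsub>B\<^esub> x))"
    unfolding BI_simps by (intro SUP_cong refl eq)
  also have "\<dots> = \<pi> (c \<odot>\<^bsub>B\<^esub> x)"
    using I.a_rcos_self[OF x] by blast
  finally show ?thesis .
qed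

lemma \<pi>_hom:
  assumes "x \<in> carrier B" "y \<in> carrier B"
  shows "\<pi> (x \<oplus>\<^bsub>B\<^esub> y) = \<pi> x \<oplus>\<^bsub>BI\<^esub> \<pi> y" "\<pi> (x \<otimes>\<^bsub>B\<^esub> y) = \<pi> x \<otimes>\<^bsub>BI\<^esub> \<pi> y"
  using ring_hom_add[OF I.rcos_ring_hom assms] ring_hom_mult[OF I.rcos_ring_hom assms]
  by (simp_all add: BI_simps)

lemma linear_map_\<pi>: "linear_map K B BI \<pi>"
  by (auto simp: linear_map_def BI_carrier \<pi>_hom \<pi>_smult)

lemma quotient_algebra: "algebra K BI"
proof -
  interpret Qt: cring "B Quot I" by (rule I.quotient_is_cring[OF A.M_cring])
  have cr: "cring BI"
    by (rule cringI; (rule abelian_groupI comm_monoidI)?)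
      (auto simp: BI_simps(1-5) Qt.m_ac Qt.a_ac Qt.l_distr Qt.r_distr
        intro: Qt.add.l_inv_ex)
  have mem: "\<exists>x\<in>carrier B. \<xi> = \<pi> x" if "\<xi> \<in> carrier BI" for \<xi>
    using that unfolding BI_carrier by blast
  have cl: "\<pi> x \<in> carrier BI" if "x \<in> carrier B" for x
    using that unfolding BI_carrier by blast
  show ?thesis
  proof (rule algebraI[OF A.R_cring cr])
    show "a \<odot>\<^bsub>BI\<^esub> \<xi> \<in> carrier BI" if prems: "a \<in> carrier K" "\<xi> \<in> carrier BI" for a \<xi>
      using mem[OF prems(2)] prems(1) by (auto simp: \<pi>_smult cl)
    show "(a \<oplus>\<^bsub>K\<^esub> b) \<odot>\<^bsub>BI\<^esub> \<xi> = a \<odot>\<^bsub>BI\<^esub> \<xi> \<oplus>\<^bsub>BI\<^esub> b \<odot>\<^bsub>BI\<^esub> \<xi>"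
      if prems: "a \<in> carrier K" "b \<in> carrier K" "\<xi> \<in> carrier BI" for a b \<xi>
    proof -
      obtain x where "x \<in> carrier B" "\<xi> = \<pi> x" using mem[OF prems(3)] by blast
      with prems(1,2) show ?thesis by (simp add: \<pi>_smult A.smult_l_distr \<pi>_hom)
    qed
    show "a \<odot>\<^bsub>BI\<^esub> (\<xi> \<oplus>\<^bsub>BI\<^esub> \<upsilon>) = a \<odot>\<^bsub>BI\<^esub> \<xi> \<oplus>\<^bsub>BI\<^esub> a \<odot>\<^bsub>BI\<^esub> \<upsilon>"
      if prems: "a \<in> carrier K" "\<xi> \<in> carrier BI" "\<upsilon> \<in> carrier BI" for a \<xi> \<upsilon>
    proof -
      obtain x y where "x \<in> carrier B" "\<xi> = \<pi> x" "y \<in> carrier B" "\<upsilon> = \<pi> y"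
        using mem[OF prems(2)] mem[OF prems(3)] by blast
      with prems(1) show ?thesis
        by (simp add: \<pi>_smult A.smult_r_distr \<pi>_hom(1)[symmetric])
    qed
    show "(a \<otimes>\<^bsub>K\<^esub> b) \<odot>\<^bsub>BI\<^esub> \<xi> = a \<odot>\<^bsub>BI\<^esub> (b \<odot>\<^bsub>BI\<^esub> \<xi>)"
      if prems: "a \<in> carrier K" "b \<in> carrier K" "\<xi> \<in> carrier BI" for a b \<xi>
    proof -
      obtain x where "x \<in> carrier B" "\<xi> = \<pi> x" using mem[OF prems(3)] by blast
      with prems(1,2) show ?thesis by (simp add: \<pi>_smult A.smult_assoc1)
    qed
    show "\<one>\<^bsub>K\<^esub> \<odot>\<^bsub>BI\<^esub> \<xi> = \<xi>" if prems: "\<xi> \<in> carrier BI" for \<xi>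
    proof -
      obtain x where "x \<in> carrier B" "\<xi> = \<pi> x" using mem[OF prems] by blast
      then show ?thesis by (simp add: \<pi>_smult)
    qed
    show "(a \<odot>\<^bsub>BI\<^esub> \<xi>) \<otimes>\<^bsub>BI\<^esub> \<upsilon> = a \<odot>\<^bsub>BI\<^esub> (\<xi> \<otimes>\<^bsub>BI\<^esub> \<upsilon>)"
      if prems: "a \<in> carrier K" "\<xi> \<in> carrier BI" "\<upsilon> \<in> carrier BI" for a \<xi> \<upsilon>
    proof -
      obtain x y where "x \<in> carrier B" "\<xi> = \<pi> x" "y \<in> carrier B" "\<upsilon> = \<pi> y"
        using mem[OF prems(2)] mem[OF prems(3)] by blast
      with prems(1) show ?thesis
        by (simp add: \<pi>_smult A.smult_assoc2 \<pi>_hom(2)[symmetric])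
    qed
  qed
qed

end

section \<open>The kernel of reduction modulo an ideal\<close>

locale tensor_reduction = algebra_ideal K B I + V: module K V
  for K :: "('k, 'x) ring_scheme" and V :: "('k, 'm) module" and B :: "('k, 'b) module"
    and I :: "'b set"
begin

lemma reduction_functoriality: "tensor_functoriality K V B V BI (\<lambda>v. v) \<pi>"
proof -
  interpret Q: algebra K BI by (rule quotient_algebra)
  show ?thesis
    by (intro tensor_functoriality.intro tensor_functoriality_axioms.intro tensor_product.intro
        V.module_axioms A.module Q.module linear_map_\<pi>) (simp add: linear_map_def)
qed

lemma reduction_eq: "reduction K V B I = tensor_map K V BI (\<lambda>v. v) \<pi>"
  by (rule ext) (simp add: reduction_def tensor_map_def)

sublocale red: tensor_functoriality K V B V BI "\<lambda>v. v" \<pi>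
  by (rule reduction_functoriality)

lemmas reduction_closed = red.tensor_map_closed[folded reduction_eq]
lemmas reduction_add = red.tensor_map_add[folded reduction_eq]
lemmas reduction_tens = red.tensor_map_tens[folded reduction_eq]
lemmas reduction_cls = red.tensor_map_cls[folded reduction_eq]

lemma reduction_surj:
  "\<xi> \<in> carrier red.D.T \<Longrightarrow> \<exists>\<upsilon>\<in>carrier red.S.T. reduction K V B I \<upsilon> = \<xi>"
proof (induction rule: red.D.tens_induct)
  case (tens v c)
  then obtain b where "b \<in> carrier B" "c = \<pi> b" by (auto simp: BI_carrier)
  with tens show ?case
    by (intro bexI[of _ "tens K V B v b"]) (simp_all add: reduction_tens)
next
  case (add \<xi> \<xi>')
  then obtain \<upsilon> \<upsilon>' where "\<upsilon> \<in> carrier red.S.T" "\<upsilon>' \<in> carrier red.S.T"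
    "reduction K V B I \<upsilon> = \<xi>" "reduction K V B I \<upsilon>' = \<xi>'" by blast
  then show ?case
    by (intro bexI[of _ "\<upsilon> \<oplus>\<^bsub>red.S.T\<^esub> \<upsilon>'"]) (simp_all add: reduction_add)
qed

definition ideal_tensors where
  "ideal_tensors = generate (add_monoid red.S.T) {tens K V B v i | v i. v \<in> carrier V \<and> i \<in> I}"

lemma ideal_tensors_subgroup: "subgroup ideal_tensors (add_monoid red.S.T)"
  unfolding ideal_tensors_def
  by (rule group.generate_is_subgroup[OF red.S.T.a_group]) (auto intro: I.Icarr)

text \<open>
  Right exactness of the tensor product. Modulo the tensors \<open>v \<otimes> i\<close>, the tensor \<open>v \<otimes> b\<close> depends only
  on \<open>v\<close> and the coset of \<open>b\<close>. This gives a map \<open>\<Phi>\<close> back from \<open>V \<otimes> B/I\<close> to the quotient of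
  \<open>V \<otimes> B\<close> by these tensors. Composed with the reduction it is the quotient map \<open>q\<close>, so \<open>q\<close> vanishes
  on the kernel of the reduction.
\<close>

theorem reduction_kernel:
  assumes \<xi>: "\<xi> \<in> carrier red.S.T" and zero: "reduction K V B I \<xi> = \<zero>\<^bsub>red.D.T\<^esub>"
  shows "\<xi> \<in> ideal_tensors"
proof -
  let ?M = "add_monoid red.S.T"
  define A where "A = ?M Mod ideal_tensors"
  define q where "q \<xi> = ideal_tensors #>\<^bsub>?M\<^esub> \<xi>" for \<xi>
  interpret A: comm_group A
    unfolding A_def
    by (rule comm_group.abelian_FactGroup[OF red.S.T.a_comm_group ideal_tensors_subgroup])
  have normal: "normal ideal_tensors ?M"
    by (rule comm_group.subgroup_imp_normal[OF red.S.T.a_comm_group ideal_tensors_subgroup])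
  have q_hom: "q \<in> hom ?M A"
    unfolding q_def A_def by (rule normal.r_coset_hom_Mod[OF normal])
  then interpret q: group_hom ?M A q
    by (simp add: group_hom_def group_hom_axioms_def red.S.T.a_group)
  have q_one: "q \<upsilon> = \<one>\<^bsub>A\<^esub> \<longleftrightarrow> \<upsilon> \<in> ideal_tensors" if "\<upsilon> \<in> carrier red.S.T" for \<upsilon>
    using group.coset_join1[OF red.S.T.a_group _ _ ideal_tensors_subgroup]
      subgroup.rcos_const[OF ideal_tensors_subgroup red.S.T.a_group] that
    unfolding q_def A_def by (auto simp: subgroup.subset[OF ideal_tensors_subgroup])
  have q_add: "q (\<upsilon> \<oplus>\<^bsub>red.S.T\<^esub> \<upsilon>') = q \<upsilon> \<otimes>\<^bsub>A\<^esub> q \<upsilon>'"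
    if "\<upsilon> \<in> carrier red.S.T" "\<upsilon>' \<in> carrier red.S.T" for \<upsilon> \<upsilon>'
    using q.hom_mult that by simp
  have q_closed: "q \<upsilon> \<in> carrier A" if "\<upsilon> \<in> carrier red.S.T" for \<upsilon>
    using q.hom_closed that by simp
  have q_cong: "q (tens K V B v b) = q (tens K V B v b')"
    if "\<pi> b = \<pi> b'" "v \<in> carrier V" "b \<in> carrier B" "b' \<in> carrier B" for v b b'
  proof -
    have i: "b \<ominus>\<^bsub>B\<^esub> b' \<in> I" using that \<pi>_eq_iff by blast
    have "b = b' \<oplus>\<^bsub>B\<^esub> (b \<ominus>\<^bsub>B\<^esub> b')" using that by algebra
    then have "tens K V B v b = tens K V B v b' \<oplus>\<^bsub>red.S.T\<^esub> tens K V B v (b \<ominus>\<^bsub>B\<^esub> b')"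
      using red.S.tens_add_right[of v b' "b \<ominus>\<^bsub>B\<^esub> b'"] that by simp
    moreover have "q (tens K V B v (b \<ominus>\<^bsub>B\<^esub> b')) = \<one>\<^bsub>A\<^esub>"
      using that i by (subst q_one) (auto simp: ideal_tensors_def intro!: generate.incl)
    ultimately show ?thesis
      using that by (simp add: q_add q_closed)
  qed
  \<comment> \<open>A set-theoretic section of \<open>\<pi>\<close>; it is additive and linear only modulo \<open>I\<close>, which suffices.\<close>
  define \<rho> where "\<rho> c = (SOME b. b \<in> carrier B \<and> \<pi> b = c)" for c
  have \<rho>: "\<rho> c \<in> carrier B" "\<pi> (\<rho> c) = c" if "c \<in> carrier BI" for c
    using that someI_ex[of "\<lambda>b. b \<in> carrier B \<and> \<pi> b = c"] unfolding \<rho>_def BI_carrier by auto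
  obtain \<Phi> where \<Phi>: "\<Phi> \<in> hom red.D.Free A"
    and \<Phi>_tens: "\<And>x. x \<in> carrier V \<times> carrier BI \<Longrightarrow>
      \<Phi> (frag_of x) = (\<lambda>(v, c). q (tens K V B v (\<rho> c))) x"
    by (rule A.free_Abelian_group_universal[of "\<lambda>(v, c). q (tens K V B v (\<rho> c))"
          "carrier V \<times> carrier BI"]) (use \<rho> q_closed in auto)
  interpret \<Phi>: group_hom red.D.Free A \<Phi>
    by (simp add: group_hom_def group_hom_axioms_def \<Phi>)
  have \<Phi>_respects: "\<Phi> y = \<Phi> x" if "x \<in> carrier red.D.Free" "y \<in> red.D.cls x" for x y
  proof (rule red.D.hom_respects_relations[OF A.comm_group_axioms \<Phi> _ _ _ that])
    fix v w r s c
    assume v: "v \<in> carrier V" and r: "r \<in> carrier BI"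
    show "\<Phi> (frag_of (v \<oplus>\<^bsub>V\<^esub> w, r)) = \<Phi> (frag_of (v, r)) \<otimes>\<^bsub>A\<^esub> \<Phi> (frag_of (w, r))"
      if "w \<in> carrier V"
      using v r that \<rho>[OF r] by (simp add: \<Phi>_tens red.S.tens_add_left q_add)
    show "\<Phi> (frag_of (v, r \<oplus>\<^bsub>BI\<^esub> s)) = \<Phi> (frag_of (v, r)) \<otimes>\<^bsub>A\<^esub> \<Phi> (frag_of (v, s))"
      if s: "s \<in> carrier BI"
    proof -
      have rs: "r \<oplus>\<^bsub>BI\<^esub> s \<in> carrier BI" using r s by simp
      have "q (tens K V B v (\<rho> (r \<oplus>\<^bsub>BI\<^esub> s))) = q (tens K V B v (\<rho> r \<oplus>\<^bsub>B\<^esub> \<rho> s))"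
        using v \<rho>[OF r] \<rho>[OF s] \<rho>[OF rs] by (intro q_cong) (simp_all add: \<pi>_hom)
      then show ?thesis
        using v r s rs \<rho>[OF r] \<rho>[OF s] by (simp add: \<Phi>_tens red.S.tens_add_right q_add)
    qed
    show "\<Phi> (frag_of (c \<odot>\<^bsub>V\<^esub> v, r)) = \<Phi> (frag_of (v, c \<odot>\<^bsub>BI\<^esub> r))" if c: "c \<in> carrier K"
    proof -
      have cr: "c \<odot>\<^bsub>BI\<^esub> r \<in> carrier BI" using c r by simp
      have "q (tens K V B v (c \<odot>\<^bsub>B\<^esub> \<rho> r)) = q (tens K V B v (\<rho> (c \<odot>\<^bsub>BI\<^esub> r)))"
        using v c \<rho>[OF r] \<rho>[OF cr] \<pi>_smult[OF c, of "\<rho> r"] by (intro q_cong) simp_all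
      then show ?thesis
        using v c r cr \<rho>[OF r] by (simp add: \<Phi>_tens red.S.tens_smult)
    qed
  qed
  let ?red = "frag_extend (\<lambda>(v, b). frag_of (v, \<pi> b))"
  have q_cls: "group_hom red.S.Free A (\<lambda>x. q (red.S.cls x))"
    using hom_compose[OF red.S.cls_hom q_hom]
    by (simp add: group_hom_def group_hom_axioms_def o_def)
  have \<Phi>_red: "\<Phi> (?red x) = q (red.S.cls x)" if "x \<in> carrier red.S.Free" for x
    using that
  proof (induction rule: red.S.Free_induct)
    case (tens v b)
    then have "\<pi> b \<in> carrier BI" by (simp add: BI_carrier)
    with tens \<rho> show ?case
      by (simp add: \<Phi>_tens tens_def[symmetric] q_cong[of "\<rho> (\<pi> b)" b])
  next
    case (diff x y)
    then show ?case
      using red.D.hom_minus[OF \<Phi>.group_hom_axioms red.frag_closed red.frag_closed]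
        red.S.hom_minus[OF q_cls]
      by (simp only: frag_extend_diff)
  qed
  obtain x where x: "x \<in> carrier red.S.Free" "\<xi> = red.S.cls x"
    using \<xi> by (rule red.S.T_memE)
  have "red.D.cls (?red x) = red.D.cls 0"
    using zero x reduction_cls[OF x(1)] red.D.cls_Rel[of 0]
      subgroup.one_closed[OF red.D.relations_subgroup] by simp
  then have "?red x \<in> red.D.cls 0"
    using red.D.cls_self[OF red.frag_closed[OF x(1)]] by simp
  then have "\<Phi> (?red x) = \<Phi> 0"
    by (intro \<Phi>_respects) simp_all
  then have "q \<xi> = \<one>\<^bsub>A\<^esub>"
    using \<Phi>_red[OF x(1)] x(2) \<Phi>.hom_one by simp
  then show ?thesis using q_one[OF \<xi>] by simp
qed

end

section \<open>Reduction as a square-zero extension\<close>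

locale dg_reduction = P: dg_category K P + algebra_ideal K B I
  for K :: "('k, 'x) ring_scheme" and P :: "('o, 'k, 'm) dgcat" and B :: "('k, 'b) module"
    and I :: "'b set" +
  assumes I_square: "I \<cdot>\<^bsub>B\<^esub> I = {\<zero>\<^bsub>B\<^esub>}"
begin

sublocale S: dg_scalar_extension K P B
  by (intro dg_scalar_extension.intro P.dg_category_axioms A.algebra_axioms)

sublocale D: dg_scalar_extension K P BI
  by (intro dg_scalar_extension.intro P.dg_category_axioms quotient_algebra)

abbreviation rd where "rd E F i \<equiv> reduction K (Hom P E F i) B I"

lemma tensor_reduction_Hom:
  "E \<in> Ob P \<Longrightarrow> F \<in> Ob P \<Longrightarrow> tensor_reduction K (Hom P E F i) B I"
  by (intro tensor_reduction.intro algebra_ideal_axioms P.Hom_module)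

lemmas rd_closed = tensor_reduction.reduction_closed[OF tensor_reduction_Hom,
    folded S.Hom_eq D.Hom_eq]
lemmas rd_add = tensor_reduction.reduction_add[OF tensor_reduction_Hom, folded S.Hom_eq D.Hom_eq]
lemmas rd_tens = tensor_reduction.reduction_tens[OF tensor_reduction_Hom]
lemmas rd_surj = tensor_reduction.reduction_surj[OF tensor_reduction_Hom,
    folded S.Hom_eq D.Hom_eq]
lemmas rd_kernel = tensor_reduction.reduction_kernel[OF tensor_reduction_Hom,
    folded S.Hom_eq D.Hom_eq]

lemma mult_ideal: "i \<in> I \<Longrightarrow> j \<in> I \<Longrightarrow> i \<otimes>\<^bsub>B\<^esub> j = \<zero>\<^bsub>B\<^esub>"
  using ideal_prod.prod[of i I j I B] I_square by simp

text \<open>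
  On generators, \<open>(w \<otimes> i)(v \<otimes> j) = wv \<otimes> ij = 0\<close>.
\<close>

lemma Comp_ideal_tensors:
  assumes O: "E \<in> Ob P" "F \<in> Ob P" "G \<in> Ob P"
    and b: "b \<in> tensor_reduction.ideal_tensors K (Hom P F G j) B I"
    and a: "a \<in> tensor_reduction.ideal_tensors K (Hom P E F i) B I"
  shows "Comp S.PR E F G j i b a = \<zero>\<^bsub>Hom S.PR E G (j + i)\<^esub>"
proof -
  interpret PB: dg_category B S.PR by (rule S.dg_category_base_change)
  interpret r1: tensor_reduction K "Hom P F G j" B I using O by (intro tensor_reduction_Hom)
  interpret r2: tensor_reduction K "Hom P E F i" B I using O by (intro tensor_reduction_Hom)
  interpret H1: abelian_group "Hom S.PR F G j"
    using O by (intro PB.Hom_abelian_group) (simp_all add: S.Ob_eq)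
  interpret H2: abelian_group "Hom S.PR E F i"
    using O by (intro PB.Hom_abelian_group) (simp_all add: S.Ob_eq)
  interpret H3: abelian_group "Hom S.PR E G (j + i)"
    using O by (intro PB.Hom_abelian_group) (simp_all add: S.Ob_eq)
  have c1: "x \<in> carrier (Hom S.PR F G j)" if "x \<in> r1.ideal_tensors" for x
    using subgroup.subset[OF r1.ideal_tensors_subgroup] that by (auto simp: S.Hom_eq)
  have c2: "x \<in> carrier (Hom S.PR E F i)" if "x \<in> r2.ideal_tensors" for x
    using subgroup.subset[OF r2.ideal_tensors_subgroup] that by (auto simp: S.Hom_eq)
  have O': "E \<in> Ob S.PR" "F \<in> Ob S.PR" "G \<in> Ob S.PR" using O by (simp_all add: S.Ob_eq)
  have pure: "Comp S.PR E F G j i (S.tn F G j w s) x = \<zero>\<^bsub>Hom S.PR E G (j + i)\<^esub>"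
    if "w \<in> carrier (Hom P F G j)" "s \<in> I" "x \<in> r2.ideal_tensors" for w s x
    using that(3) unfolding r2.ideal_tensors_def S.Hom_eq[symmetric]
  proof (induction rule: generate.induct)
    case one
    show ?case using PB.Comp_zero_right[OF O' S.tn_closed] that(1,2) O by (simp add: I.Icarr)
  next
    case (incl x)
    then show ?case
      using that(1,2) O
      by (auto simp: S.PR_Comp_tens I.Icarr mult_ideal S.tn_zero_right P.Comp_closed)
  next
    case (inv x)
    then obtain v r where "v \<in> carrier (Hom P E F i)" "r \<in> I" "x = S.tn E F i v r" by blast
    then show ?case
      using that(1,2) O PB.Comp_minus_right[OF O', of "S.tn F G j w s" j x i]
      by (auto simp: S.PR_Comp_tens I.Icarr mult_ideal S.tn_zero_right P.Comp_closed S.tn_closed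
          simp flip: a_inv_def)
  next
    case (eng x y)
    then have "x \<in> carrier (Hom S.PR E F i)" "y \<in> carrier (Hom S.PR E F i)"
      using c2 unfolding r2.ideal_tensors_def S.Hom_eq[symmetric] by blast+
    with eng that(1,2) O show ?case
      by (simp add: S.PR_Comp_add_right S.tn_closed I.Icarr)
  qed
  show ?thesis
    using b unfolding r1.ideal_tensors_def S.Hom_eq[symmetric]
  proof (induction rule: generate.induct)
    case one
    show ?case using PB.Comp_zero_left[OF O' c2[OF a]] by simp
  next
    case (incl x)
    then show ?case using pure a by auto
  next
    case (inv x)
    then obtain w s where "w \<in> carrier (Hom P F G j)" "s \<in> I" "x = S.tn F G j w s" by blast
    then show ?case
      using pure a O PB.Comp_minus_left[OF O' c2[OF a], of x j]
      by (auto simp: I.Icarr S.tn_closed simp flip: a_inv_def)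
  next
    case (eng x y)
    then have "x \<in> carrier (Hom S.PR F G j)" "y \<in> carrier (Hom S.PR F G j)"
      using c1 unfolding r1.ideal_tensors_def S.Hom_eq[symmetric] by blast+
    with eng O c2[OF a] show ?case
      by (simp add: S.PR_Comp_add_left)
  qed
qed

theorem square_zero_extension_reduction: "square_zero_extension B S.PR BI D.PR rd"
proof -
  note [simp] = S.Ob_eq D.Ob_eq rd_closed rd_add rd_tens linear_mapD[OF linear_map_\<pi>]
    S.PR_Diff_closed S.PR_Diff_add S.PR_Diff_tens D.PR_Diff_add D.PR_Diff_tens
    S.PR_Comp_closed S.PR_Comp_tens S.PR_Comp_add_left S.PR_Comp_add_right
    D.PR_Comp_tens D.PR_Comp_add_left D.PR_Comp_add_right P.Diff_closed P.Comp_closed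
    P.Ident_closed S.tn_closed D.tn_closed
  show ?thesis
  proof (intro square_zero_extension.intro square_zero_extension_axioms.intro
      S.dg_category_base_change D.dg_category_base_change, unfold S.Ob_eq D.Ob_eq)
    fix E F i a assume EF: "E \<in> Ob P" "F \<in> Ob P" and a: "a \<in> carrier (Hom S.PR E F i)"
    show "rd E F (i + 1) (Diff S.PR E F i a) = Diff D.PR E F i (rd E F i a)"
      using EF a by (induction rule: S.Hom_induct) (use EF in simp_all)
  next
    fix E F G j i b a
    assume O: "E \<in> Ob P" "F \<in> Ob P" "G \<in> Ob P"
      and b: "b \<in> carrier (Hom S.PR F G j)" and a: "a \<in> carrier (Hom S.PR E F i)"
    show "rd E G (j + i) (Comp S.PR E F G j i b a) =
        Comp D.PR E F G j i (rd F G j b) (rd E F i a)"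
      using O(2,3) b
    proof (induction rule: S.Hom_induct)
      case b: (tens w s)
      show ?case
        using O(1,2) a by (induction rule: S.Hom_induct) (use O b in \<open>simp_all add: \<pi>_hom\<close>)
    qed (use O a in simp_all)
    assume "rd F G j b = \<zero>\<^bsub>Hom D.PR F G j\<^esub>" "rd E F i a = \<zero>\<^bsub>Hom D.PR E F i\<^esub>"
    then show "Comp S.PR E F G j i b a = \<zero>\<^bsub>Hom S.PR E G (j + i)\<^esub>"
      using O a b by (intro Comp_ideal_tensors rd_kernel)
  next
    fix E assume "E \<in> Ob P"
    then show "rd E E 0 (Ident S.PR E) = Ident D.PR E"
      by (simp add: S.Ident_eq D.Ident_eq) (simp add: BI_simps FactRing_def)
  qed (use rd_surj in auto)
qed

end

section \<open>Lifting along a homotopy equivalence\<close>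

theorem mainTheorem1:
  fixes k :: "('k, 'x) ring_scheme"
    and P :: "('o, 'k, 'm) dgcat"
    and B :: "('k, 'b) module"
    and I :: "'b set"
    and E F :: 'o
    and \<eta> :: "('m \<times> 'b \<Rightarrow>\<^sub>0 int) set"
    and \<eta>\<^sub>I \<zeta>\<^sub>I \<alpha>\<^sub>I a\<^sub>I :: "('m \<times> 'b set \<Rightarrow>\<^sub>0 int) set"
  defines "P\<^sub>B \<equiv> dg_base_change k P B"
    and "P\<^sub>B\<^sub>I \<equiv> dg_base_change k P (quot_algebra B I)"
  assumes k: "algebraically_closed k" "char_zero k"
    and P: "dg_category k P"
    and finite_Ob: "finite (Ob P)"
    and finite_dim_Hom: "\<forall>E\<in>Ob P. \<forall>F\<in>Ob P. \<forall>i. finite_dim k (Hom P E F i)"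
    and bounded_below: "\<exists>n::nat. n > 0 \<and>
      (\<forall>E\<in>Ob P. \<forall>F\<in>Ob P. \<forall>i. i < - int n \<longrightarrow> carrier (Hom P E F i) = {\<zero>\<^bsub>Hom P E F i\<^esub>})"
    and B: "algebra k B"
    and I: "ideal I B" "I \<cdot>\<^bsub>B\<^esub> I = {\<zero>\<^bsub>B\<^esub>}"
    and E: "(E, \<eta>) \<in> Ob (MC P\<^sub>B)"
    and F: "(F, \<zeta>\<^sub>I) \<in> Ob (MC P\<^sub>B\<^sub>I)"
    and \<eta>\<^sub>I: "\<eta>\<^sub>I = reduction k (Hom P E E 1) B I \<eta>"
    and \<alpha>\<^sub>I: "\<alpha>\<^sub>I \<in> closed0 (MC P\<^sub>B\<^sub>I) (F, \<zeta>\<^sub>I) (E, \<eta>\<^sub>I)"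
    and a\<^sub>I: "a\<^sub>I \<in> closed0 (MC P\<^sub>B\<^sub>I) (E, \<eta>\<^sub>I) (F, \<zeta>\<^sub>I)"
    and inverse: "mutually_inverse (H0 (MC P\<^sub>B\<^sub>I)) (F, \<zeta>\<^sub>I) (E, \<eta>\<^sub>I)
      (H0_class (MC P\<^sub>B\<^sub>I) (F, \<zeta>\<^sub>I) (E, \<eta>\<^sub>I) \<alpha>\<^sub>I)
      (H0_class (MC P\<^sub>B\<^sub>I) (E, \<eta>\<^sub>I) (F, \<zeta>\<^sub>I) a\<^sub>I)"
  shows "\<exists>\<zeta>\<in>carrier (Hom P\<^sub>B F F 1). \<exists>\<alpha>\<in>carrier (Hom P\<^sub>B F E 0).
    reduction k (Hom P F F 1) B I \<zeta> = \<zeta>\<^sub>I \<and>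
    reduction k (Hom P F E 0) B I \<alpha> = \<alpha>\<^sub>I \<and>
    Diff P\<^sub>B F F 1 \<zeta> \<oplus>\<^bsub>Hom P\<^sub>B F F 2\<^esub> Comp P\<^sub>B F F F 1 1 \<zeta> \<zeta> = \<zero>\<^bsub>Hom P\<^sub>B F F 2\<^esub> \<and>
    twisted_Diff P\<^sub>B F E \<zeta> \<eta> 0 \<alpha> = \<zero>\<^bsub>Hom P\<^sub>B F E 1\<^esub>"
proof -
  interpret dg_reduction k P B I
    by (intro dg_reduction.intro dg_reduction_axioms.intro algebra_ideal.intro P B I)
  interpret X: square_zero_extension B P\<^sub>B "quot_algebra B I" P\<^sub>B\<^sub>I rd
    unfolding P\<^sub>B_def P\<^sub>B\<^sub>I_def by (rule square_zero_extension_reduction)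
  have O: "E \<in> Ob P\<^sub>B" "F \<in> Ob P\<^sub>B"
    and \<eta>: "\<eta> \<in> carrier (Hom P\<^sub>B E E 1)" "X.Q.curvature E \<eta> = \<zero>\<^bsub>Hom P\<^sub>B E E 2\<^esub>"
    and \<zeta>\<^sub>I: "\<zeta>\<^sub>I \<in> carrier (Hom P\<^sub>B\<^sub>I F F 1)" "X.Q'.curvature F \<zeta>\<^sub>I = \<zero>\<^bsub>Hom P\<^sub>B\<^sub>I F F 2\<^esub>"
    using E F X.Ob_eq
    by (simp_all add: MC_def MC_elements_def X.Q.curvature_def X.Q'.curvature_def)
  have \<alpha>: "\<alpha>\<^sub>I \<in> carrier (Hom P\<^sub>B\<^sub>I F E 0)"
      "twisted_Diff P\<^sub>B\<^sub>I F E \<zeta>\<^sub>I \<eta>\<^sub>I 0 \<alpha>\<^sub>I = \<zero>\<^bsub>Hom P\<^sub>B\<^sub>I F E 1\<^esub>"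
    and a: "a\<^sub>I \<in> carrier (Hom P\<^sub>B\<^sub>I E F 0)"
      "twisted_Diff P\<^sub>B\<^sub>I E F \<eta>\<^sub>I \<zeta>\<^sub>I 0 a\<^sub>I = \<zero>\<^bsub>Hom P\<^sub>B\<^sub>I E F 1\<^esub>"
    using \<alpha>\<^sub>I a\<^sub>I by (simp_all add: closed0_def MC_def)
  have O': "E \<in> Ob P\<^sub>B\<^sub>I" "F \<in> Ob P\<^sub>B\<^sub>I" and \<eta>': "\<eta>\<^sub>I \<in> carrier (Hom P\<^sub>B\<^sub>I E E 1)"
    using O X.Ob_eq X.p_closed[OF O(1,1) \<eta>(1)] by (simp_all add: \<eta>\<^sub>I)
  obtain g where g: "g \<in> carrier (Hom P\<^sub>B\<^sub>I F F (-1))" "Comp P\<^sub>B\<^sub>I F E F 0 0 a\<^sub>I \<alpha>\<^sub>I =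
      twisted_Diff P\<^sub>B\<^sub>I F F \<zeta>\<^sub>I \<zeta>\<^sub>I (-1) g \<oplus>\<^bsub>Hom P\<^sub>B\<^sub>I F F 0\<^esub> Ident P\<^sub>B\<^sub>I F"
    using X.Q'.H0_inverse_homotopy[OF O'(2,1) \<zeta>\<^sub>I(1) \<eta>' \<alpha>(1) a(1)] inverse
    unfolding mutually_inverse_def by blast
  obtain h where h: "h \<in> carrier (Hom P\<^sub>B\<^sub>I E E (-1))" "Comp P\<^sub>B\<^sub>I E F E 0 0 \<alpha>\<^sub>I a\<^sub>I =
      twisted_Diff P\<^sub>B\<^sub>I E E \<eta>\<^sub>I \<eta>\<^sub>I (-1) h \<oplus>\<^bsub>Hom P\<^sub>B\<^sub>I E E 0\<^esub> Ident P\<^sub>B\<^sub>I E"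
    using X.Q'.H0_inverse_homotopy[OF O' \<eta>' \<zeta>\<^sub>I(1) a(1) \<alpha>(1)] inverse
    unfolding mutually_inverse_def by blast
  show ?thesis
    using X.homotopy_equivalence_lifts[OF O \<eta> \<zeta>\<^sub>I \<alpha>(1) _ a(1) _ g h[unfolded \<eta>\<^sub>I]] \<alpha>(2) a(2)
    by (simp add: \<eta>\<^sub>I X.Q.curvature_def)
qed

end
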